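(* Let $d\ge 2$ and let $U\ne\emptyset$ be a connected open set in $\mathbb R^d$ such that, if $d=2$, the complement $\mathbb R^2\setminus U$ is nonpolar. Let $A$ and $B$ be relatively closed subsets of $U$ and $\kappa>0$ such that $A$ is unavoidable in $U$ and $$P^x[T_B<T_{U^c}]\ge \kappa\qquad\text{for every } x\in A.$$ Then $B$ is unavoidable in $U$.
   Context: $(X_t)$ denotes Brownian motion on $\mathbb R^d$ and $P^x$ the probability measure under which it starts at $x$. For Borel sets $E$, $T_E(\omega):=\inf\{t\ge 0\colon X_t(\omega)\in E\}$ is the entry time of $E$, and $U^c=\mathbb R^d\setminus U$. A relatively closed subset $A$ of $U$ is called unavoidable in $U$ if Brownian motion, starting in any point of $U\setminus A$ and killed when leaving $U$, hits $A$ almost surely (that is, $P^y[T_A<T_{U^c}]=1$ for every $y\in U\setminus A$) or, equivalently, if $\mu_y^{U\setminus A}(A)=1$ for every $y\in U\setminus A$, where $\mu_y^{U\setminus A}$ is the harmonic measure at $y$ with respect to $U\setminus A$. Polar sets are understood in the sense of classical potential theory. *)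

theory Defs
  imports "HOL-Probability.Probability"
begin

text \<open>
  Increments after time \<open>s\<close> are independent of the natural filtration
  \<open>\<sigma>(X u : 0 \<le> u \<le> s)\<close>. The increment has law \<open>N(0, (t - s) I)\<close>. All paths are
  continuous on the time axis \<open>[0, \<infinity>)\<close>, so that the events used below are measurable without
  completing the sigma-algebra. The starting condition can hold only almost surely, since one
  process \<open>X\<close> serves for all starting points.
\<close>

definition brownian_motion ::
  "'w measure \<Rightarrow> (real \<Rightarrow> 'w \<Rightarrow> real ^ 'n) \<Rightarrow> real ^ 'n \<Rightarrow> bool"
  where "brownian_motion M X x \<longleftrightarrow>
    prob_space M \<and>
    (\<forall>t\<ge>0. X t \<in> borel_measurable M) \<and>
    (\<forall>\<omega>\<in>space M. continuous_on {0..} (\<lambda>t. X t \<omega>)) \<and>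
    (AE \<omega> in M. X 0 \<omega> = x) \<and>
    (\<forall>s t. 0 \<le> s \<and> s < t \<longrightarrow>
      prob_space.indep_set M
        (sigma_sets (space M) {X u -` S \<inter> space M | u S. 0 \<le> u \<and> u \<le> s \<and> S \<in> sets borel})
        {(\<lambda>\<omega>. X t \<omega> - X s \<omega>) -` S \<inter> space M | S. S \<in> sets borel} \<and>
      distributed M lborel (\<lambda>\<omega>. X t \<omega> - X s \<omega>)
        (\<lambda>z. ennreal ((2 * pi * (t - s)) powr (- real CARD('n) / 2)
                       * exp (- (norm z)\<^sup>2 / (2 * (t - s))))))"

definition brownian_family ::
  "(real ^ 'n \<Rightarrow> 'w measure) \<Rightarrow> (real \<Rightarrow> 'w \<Rightarrow> real ^ 'n) \<Rightarrow> bool"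
  where "brownian_family P X \<longleftrightarrow>
    (\<forall>x y. sets (P x) = sets (P y)) \<and> (\<forall>x. brownian_motion (P x) X x)"

definition entry_time :: "(real \<Rightarrow> 'w \<Rightarrow> 'a) \<Rightarrow> 'a set \<Rightarrow> 'w \<Rightarrow> ereal"
  where "entry_time X E \<omega> = Inf (ereal ` {t. 0 \<le> t \<and> X t \<omega> \<in> E})"

definition hit_prob ::
  "('a \<Rightarrow> 'w measure) \<Rightarrow> (real \<Rightarrow> 'w \<Rightarrow> 'a) \<Rightarrow> 'a set \<Rightarrow> 'a set \<Rightarrow> 'a \<Rightarrow> real"
  where "hit_prob P X U E x =
    measure (P x) {\<omega> \<in> space (P x). entry_time X E \<omega> < entry_time X (- U) \<omega>}"

definition unavoidable ::
  "('a::topological_space \<Rightarrow> 'w measure) \<Rightarrow> (real \<Rightarrow> 'w \<Rightarrow> 'a) \<Rightarrow> 'a set \<Rightarrow> 'a set \<Rightarrow> bool"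
  where "unavoidable P X U A \<longleftrightarrow>
    closedin (top_of_set U) A \<and> (\<forall>y\<in>U - A. hit_prob P X U A y = 1)"

text \<open>
  Superharmonic functions are lower semicontinuous with values in \<open>(-\<infinity>, \<infinity>]\<close>, not identically
  infinite on any component, and dominate their means over closed balls. The integral over a ball
  is written as integral of the positive part minus integral of the negative part
  (\<open>e2ennreal\<close> sends negative numbers to \<open>0\<close>); the latter is finite because \<open>u\<close>
  is bounded below on compact subsets of \<open>V\<close>.
\<close>

definition superharmonic_on :: "'a::euclidean_space set \<Rightarrow> ('a \<Rightarrow> ereal) \<Rightarrow> bool"
  where "superharmonic_on V u \<longleftrightarrow>
    open V \<and>
    (\<forall>x\<in>V. u x \<noteq> -\<infinity>) \<and>
    (\<forall>c::ereal. open {x\<in>V. c < u x}) \<and>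
    (\<forall>C\<in>components V. \<exists>x\<in>C. u x \<noteq> \<infinity>) \<and>
    (\<forall>x r. 0 < r \<and> cball x r \<subseteq> V \<longrightarrow>
      enn2ereal (\<integral>\<^sup>+y\<in>cball x r. e2ennreal (u y) \<partial>lborel)
        - enn2ereal (\<integral>\<^sup>+y\<in>cball x r. e2ennreal (- u y) \<partial>lborel)
      \<le> ereal (measure lborel (cball x r)) * u x)"

definition polar :: "'a::euclidean_space set \<Rightarrow> bool"
  where "polar E \<longleftrightarrow>
    (\<exists>V u. E \<subseteq> V \<and> superharmonic_on V u \<and> (\<forall>x\<in>E. u x = \<infinity>))"

end

theory Submission imports Defs begin

text \<open>
  Let \<open>h x\<close> be the probability that a Brownian motion from \<open>x\<close> hits \<open>B\<close> before leaving \<open>U\<close>, fix a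
  starting point \<open>y\<close> in \<open>U - B\<close>, and let \<open>D\<close> be the event that \<open>B\<close> is hit before \<open>U\<close> is left. If \<open>W\<close>
  is an event of the past at time \<open>t\<close> on which the path has stayed in \<open>U - B\<close> up to time \<open>t\<close>, then
  the Markov property gives \<open>P\<^sup>y(D \<inter> W) = E\<^sup>y[1\<^sub>W h(X\<^sub>t)]\<close>. So whenever the path is at a point where
  \<open>h > c\<close>, the future still hits \<open>B\<close> with conditional probability at least \<open>c\<close>, however late that is.
  Paths that never hit \<open>B\<close> meet such points arbitrarily late on their way out of \<open>U\<close>, and a fixed
  proportion of all paths that do so would still have to hit \<open>B\<close>. But a hit happens at a definite time,
  so hits that occur later and later have probability tending to zero; hence almost no path avoids \<open>B\<close>.

  The points in question form \<open>G = {x \<in> U - B. h x > \<kappa>/2}\<close>. It contains \<open>A - B\<close> by assumption, and it is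
  open because \<open>h\<close> is lower semicontinuous on \<open>U - B\<close> (\<open>hits_law_lsc\<close>): up to a small
  error, \<open>h\<close> is the expectation of \<open>h\<close> at the position a short time later, and that expectation is an
  integral against a continuous density, hence lower semicontinuous by Fatou's lemma. Openness of \<open>G\<close>
  allows its visits to be detected at rational times, where the Markov property at a fixed time
  applies.

  As \<open>A\<close> is unavoidable, the Markov property at each rational time \<open>t\<close> shows that almost surely a path
  still in \<open>U\<close> at time \<open>t\<close> hits \<open>A\<close> later on before it leaves \<open>U\<close> (\<open>unavoidable_restart\<close>). Let \<open>g\<close> be a
  continuous function that is positive exactly on \<open>U\<close>, and let \<open>H\<^sub>n\<close> be the event that at some rational
  time \<open>t\<close> the path is in \<open>G\<close>, has not left \<open>U - B\<close>, and either \<open>t \<ge> n\<close> or \<open>g\<close> has been below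
  \<open>1/(n+1)\<close> along the path before \<open>t\<close>. Then
    \<^item> \<open>H\<^sub>n\<close> contains the complement of \<open>D\<close> up to a null set (\<open>late_visit\<close>);
    \<^item> \<open>P\<^sup>y(D \<inter> H\<^sub>n) \<ge> (\<kappa>/2) P\<^sup>y(H\<^sub>n)\<close>, by splitting \<open>H\<^sub>n\<close> according to the first suitable time
      (\<open>uniform_conditional_bound_union\<close>);
    \<^item> \<open>D \<inter> H\<^sub>n\<close> decreases to the empty set, because \<open>g\<close> is bounded away from zero along
      a path up to the time at which it hits \<open>B\<close> inside \<open>U\<close>, and this time is finite.
  Hence \<open>(\<kappa>/2) P\<^sup>y(not D) \<le> P\<^sup>y(D \<inter> H\<^sub>n)\<close>, which tends to \<open>0\<close>, and \<open>D\<close> has probability one.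
\<close>

section \<open>Continuous paths observed at rational times\<close>

text \<open>
  The event \<open>T\<^sub>B < T\<^bsub>U\<^sup>c\<^esub>\<close> read along a single path, see \<open>entry_time_less_iff_hits\<close>. This form makes restarting
  a path at a later time a matter of shifting intervals.
\<close>

definition hits :: "'a set \<Rightarrow> 'a set \<Rightarrow> (real \<Rightarrow> 'a) \<Rightarrow> bool"
  where "hits U B f \<longleftrightarrow> (\<exists>t\<ge>0. f t \<in> B \<and> (\<forall>s\<in>{0..t}. f s \<in> U))"

text \<open>
  Continuity at the end point carries both properties slightly past it: staying in \<open>V\<close>, and being in \<open>W\<close>.
  Since the gained interval contains rational times, this is how an irrational time is replaced by a
  nearby rational one.
\<close>

lemma stays_longer:
  fixes f :: "real \<Rightarrow> 'a::metric_space"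
  assumes f: "continuous_on {0..} f" and "open V" "open W" "0 \<le> t" "f t \<in> W"
    and V: "\<And>s. s \<in> {0..t} \<Longrightarrow> f s \<in> V"
  obtains d where "d > 0" "\<And>s. 0 \<le> s \<Longrightarrow> s \<le> t + d \<Longrightarrow> f s \<in> V"
    "\<And>s. t \<le> s \<Longrightarrow> s \<le> t + d \<Longrightarrow> f s \<in> W"
proof -
  have "f t \<in> V \<inter> W" using assms by auto
  moreover have "open (V \<inter> W)" using assms by auto
  ultimately obtain e where e: "e > 0" "ball (f t) e \<subseteq> V \<inter> W"
    by (meson open_contains_ball)
  obtain d where d: "d > 0" "\<And>s. s \<in> {0..} \<Longrightarrow> dist s t < d \<Longrightarrow> dist (f s) (f t) < e"
    using f e(1) \<open>0 \<le> t\<close> unfolding continuous_on_iff by (metis atLeast_iff)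
  have near: "f s \<in> V \<inter> W" if "t \<le> s" "s \<le> t + d/2" for s
  proof -
    have "dist s t < d" using that d(1) by (auto simp: dist_real_def)
    then have "dist (f s) (f t) < e" using d(2) that \<open>0 \<le> t\<close> by auto
    then show ?thesis using e(2) by (auto simp: dist_commute)
  qed
  show ?thesis
  proof (rule that[of "d/2"])
    show "f s \<in> V" if "0 \<le> s" "s \<le> t + d/2" for s
      using near[of s] V[of s] that by (cases "s \<le> t") auto
  qed (use d near in auto)
qed

text \<open>
  The infimum defining the entry time of \<open>B\<close> need not be attained, but strict inequality yields a time
  in \<open>B\<close> before the exit from \<open>U\<close>. Conversely a path that lies in the open set \<open>U\<close> up to and including
  some time stays there a little longer, so its exit time is strictly larger.
\<close>

lemma entry_time_less_iff_hits:
  fixes X :: "real \<Rightarrow> 'w \<Rightarrow> 'a::metric_space"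
  assumes f: "continuous_on {0..} (\<lambda>t. X t \<omega>)" and U: "open U"
  shows "entry_time X B \<omega> < entry_time X (- U) \<omega> \<longleftrightarrow> hits U B (\<lambda>t. X t \<omega>)"
proof
  assume "entry_time X B \<omega> < entry_time X (- U) \<omega>"
  then obtain t where t: "0 \<le> t" "X t \<omega> \<in> B" "ereal t < entry_time X (- U) \<omega>"
    unfolding entry_time_def[of X B] Inf_less_iff by auto
  have "X s \<omega> \<in> U" if "s \<in> {0..t}" for s
  proof (rule ccontr)
    assume "X s \<omega> \<notin> U"
    then have "entry_time X (- U) \<omega> \<le> ereal s"
      unfolding entry_time_def using that by (intro Inf_lower) auto
    also have "\<dots> \<le> ereal t" using that by auto
    finally show False using t(3) by auto
  qed
  then show "hits U B (\<lambda>t. X t \<omega>)" using t by (auto simp: hits_def)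
next
  assume "hits U B (\<lambda>t. X t \<omega>)"
  then obtain t where t: "0 \<le> t" "X t \<omega> \<in> B" "\<And>s. s \<in> {0..t} \<Longrightarrow> X s \<omega> \<in> U"
    by (auto simp: hits_def)
  then have "X t \<omega> \<in> U" by auto
  with stays_longer[OF f U U t(1) _ t(3)] obtain d
    where d: "d > 0" "\<And>s. 0 \<le> s \<Longrightarrow> s \<le> t + d \<Longrightarrow> X s \<omega> \<in> U" by metis
  have "entry_time X B \<omega> \<le> ereal t"
    unfolding entry_time_def using t by (intro Inf_lower) auto
  also have "ereal t < ereal (t + d)" using d by auto
  also have "\<dots> \<le> entry_time X (- U) \<omega>"
    unfolding entry_time_def using d(2) by (intro Inf_greatest) force
  finally show "entry_time X B \<omega> < entry_time X (- U) \<omega>" .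
qed

text \<open>
  The distance to the complement serves, except for the whole space, whose complement is empty and
  would give \<open>infdist\<close> the default value \<open>0\<close>.
\<close>

lemma open_eq_positivity_set:
  fixes U :: "'a::metric_space set"
  assumes "open U"
  obtains g :: "'a \<Rightarrow> real"
  where "continuous_on UNIV g" "\<And>x. 0 \<le> g x" "\<And>x. x \<in> U \<longleftrightarrow> 0 < g x"
proof (cases "U = UNIV")
  case True
  then show ?thesis by (intro that[of "\<lambda>_. 1"]) auto
next
  case False
  have "closed (- U)" using assms by auto
  then have *: "x \<in> U \<longleftrightarrow> 0 < infdist x (- U)" for x
    using in_closed_iff_infdist_zero[of "- U" x] infdist_nonneg[of x "- U"] False
    by (auto simp: less_le)
  show ?thesis
    by (rule that[of "\<lambda>x. infdist x (- U)"]) (use * infdist_nonneg in \<open>auto intro!: continuous_intros\<close>)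
qed

definition rat_times :: "real set" where "rat_times = {t\<in>\<rat>. 0 \<le> t}"

lemma countable_rat_times: "countable rat_times"
  unfolding rat_times_def by (rule countable_subset[OF _ countable_rat]) auto

lemma rat_times_nonneg: "q \<in> rat_times \<Longrightarrow> 0 \<le> q"
  by (auto simp: rat_times_def)

lemma rat_times_between:
  assumes "0 \<le> a" "a < b"
  obtains q where "q \<in> rat_times" "a < q" "q < b"
  using Rats_dense_in_real[OF assms(2)] assms(1) by (auto simp: rat_times_def)

lemma lower_bound_rat_times:
  fixes \<phi> :: "real \<Rightarrow> real"
  assumes \<phi>: "continuous_on {0..} \<phi>"
    and ge: "\<And>s. s \<in> rat_times \<Longrightarrow> s \<le> t \<Longrightarrow> c \<le> \<phi> s" and s: "s \<in> {0..<t}"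
  shows "c \<le> \<phi> s"
proof (rule ccontr)
  assume "\<not> c \<le> \<phi> s"
  then have lt: "\<phi> s \<in> {..<c}" by auto
  obtain d where d: "d > 0" "\<And>u. s \<le> u \<Longrightarrow> u \<le> s + d \<Longrightarrow> \<phi> u \<in> {..<c}"
    using stays_longer[OF \<phi> open_UNIV open_lessThan _ lt] s by auto
  obtain q where "q \<in> rat_times" "s < q" "q < min t (s + d)"
    using rat_times_between[of s "min t (s + d)"] s d by auto
  with ge[of q] d(2)[of q] show False by auto
qed

text \<open>
  A path stays in an open set on a compact interval iff it keeps a positive distance from the
  complement, and a uniform bound of this kind can be tested at rational times. The end point \<open>t\<close>,
  which may be irrational, is mentioned separately.
\<close>

lemma stays_iff_rat_times:
  fixes f :: "real \<Rightarrow> 'a::metric_space"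
  assumes f: "continuous_on {0..} f" and g: "continuous_on UNIV g"
    and V: "\<And>x. x \<in> V \<longleftrightarrow> 0 < (g x :: real)" and t: "0 \<le> t"
  shows "(\<forall>s\<in>{0..t}. f s \<in> V) \<longleftrightarrow>
    f t \<in> V \<and> (\<exists>m::nat. \<forall>q\<in>rat_times. q \<le> t \<longrightarrow> inverse (Suc m) \<le> g (f q))"
proof
  have gf: "continuous_on {0..} (\<lambda>s. g (f s))"
    by (rule continuous_on_compose2[OF g f]) auto
  assume *: "\<forall>s\<in>{0..t}. f s \<in> V"
  obtain s where s: "s \<in> {0..t}" "\<And>u. u \<in> {0..t} \<Longrightarrow> g (f s) \<le> g (f u)"
    using continuous_attains_inf[of "{0..t}" "\<lambda>s. g (f s)"] continuous_on_subset[OF gf] t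
    by (metis atLeastAtMost_iff atLeast_iff compact_Icc empty_iff order_refl subsetI)
  then have "0 < g (f s)" using * V by auto
  then obtain m where "inverse (real (Suc m)) < g (f s)" using reals_Archimedean by blast
  then have "\<forall>q\<in>rat_times. q \<le> t \<longrightarrow> inverse (Suc m) \<le> g (f q)"
    using s(2) by (fastforce simp: rat_times_def)
  then show "f t \<in> V \<and> (\<exists>m::nat. \<forall>q\<in>rat_times. q \<le> t \<longrightarrow> inverse (Suc m) \<le> g (f q))"
    using * t by auto
next
  have gf: "continuous_on {0..} (\<lambda>s. g (f s))"
    by (rule continuous_on_compose2[OF g f]) auto
  assume "f t \<in> V \<and> (\<exists>m::nat. \<forall>q\<in>rat_times. q \<le> t \<longrightarrow> inverse (Suc m) \<le> g (f q))"
  then obtain m :: nat where m: "f t \<in> V" "\<And>q. q \<in> rat_times \<Longrightarrow> q \<le> t \<Longrightarrow> inverse (Suc m) \<le> g (f q)"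
    by auto
  have "f s \<in> V" if "s \<in> {0..t}" for s
  proof (cases "s = t")
    case False
    have "inverse (Suc m) \<le> g (f s)"
      using lower_bound_rat_times[OF gf m(2)] that False by auto
    moreover have "0 < inverse (real (Suc m))" by simp
    ultimately show ?thesis unfolding V by linarith
  qed (use m in auto)
  then show "\<forall>s\<in>{0..t}. f s \<in> V" by auto
qed

text \<open>
  A countable description of hitting. If \<open>F\<close> is hit at time \<open>t\<close> inside \<open>U\<close>, then rational times slightly
  after \<open>t\<close> come arbitrarily close to \<open>F\<close> while the path keeps a uniform distance from the complement of
  \<open>U\<close>. Conversely, such approximate hitting times in \<open>[0, N]\<close> have a convergent subsequence, and its
  limit is a time at which \<open>F\<close> is hit.
\<close>

lemma hits_iff_rat_times:
  fixes f :: "real \<Rightarrow> 'a::metric_space"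
  assumes f: "continuous_on {0..} f"
    and g: "continuous_on UNIV g" "\<And>x. x \<in> U \<longleftrightarrow> 0 < (g x :: real)"
    and k: "continuous_on UNIV k" "\<And>x. 0 \<le> k x" "\<And>x. x \<in> F \<longleftrightarrow> k x = (0::real)"
  shows "hits U (U \<inter> F) f \<longleftrightarrow> (\<exists>m N. \<forall>j. \<exists>q\<in>rat_times. q \<le> real N \<and> k (f q) < inverse (Suc j) \<and>
    (\<forall>s\<in>rat_times. s \<le> q \<longrightarrow> inverse (Suc m) \<le> g (f s)))" (is "?L \<longleftrightarrow> ?R")
proof
  have gf: "continuous_on {0..} (\<lambda>s. g (f s))"
    by (rule continuous_on_compose2[OF g(1) f]) auto
  have kf: "continuous_on {0..} (\<lambda>s. k (f s))"
    by (rule continuous_on_compose2[OF k(1) f]) auto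
  {
    assume ?L
    then obtain t where t: "t \<ge> 0" "f t \<in> U" "f t \<in> F" "\<forall>s\<in>{0..t}. f s \<in> U"
      by (auto simp: hits_def)
    obtain s where s: "s \<in> {0..t}" "\<And>u. u \<in> {0..t} \<Longrightarrow> g (f s) \<le> g (f u)"
      using continuous_attains_inf[of "{0..t}" "\<lambda>s. g (f s)"] continuous_on_subset[OF gf] t
      by (metis atLeastAtMost_iff atLeast_iff compact_Icc empty_iff order_refl subsetI)
    then have "0 < g (f s)" using t g(2) by auto
    then obtain m where m: "inverse (real (Suc m)) < g (f s)" using reals_Archimedean by blast
    have gm: "g (f u) \<in> {inverse (real (Suc m))<..}" if "u \<in> {0..t}" for u
      using m s(2)[OF that] by auto
    obtain N where N: "t + 1 < real N" using reals_Archimedean2 by blast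
    have "\<exists>q\<in>rat_times. q \<le> real N \<and> k (f q) < inverse (Suc j) \<and>
      (\<forall>s\<in>rat_times. s \<le> q \<longrightarrow> inverse (Suc m) \<le> g (f s))" for j
    proof -
      obtain d where d: "d > 0"
        "\<And>u. 0 \<le> u \<Longrightarrow> u \<le> t + d \<Longrightarrow> g (f u) \<in> {inverse (real (Suc m))<..}"
        using stays_longer[OF gf open_greaterThan open_UNIV t(1) _ gm] by auto
      have "k (f t) \<in> {..<inverse (real (Suc j))}" using k(3) t by auto
      then obtain d' where d': "d' > 0"
        "\<And>u. t \<le> u \<Longrightarrow> u \<le> t + d' \<Longrightarrow> k (f u) \<in> {..<inverse (real (Suc j))}"
        using stays_longer[OF kf open_UNIV open_lessThan t(1)] by auto
      obtain q where q: "q \<in> rat_times" "t < q" "q < t + min 1 (min d d')"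
        using rat_times_between[of t "t + min 1 (min d d')"] d d' t by auto
      show ?thesis
        by (rule bexI[OF _ q(1)]) (use q d(2) d'(2)[of q] N rat_times_nonneg in \<open>fastforce intro: less_imp_le\<close>)
    qed
    then show ?R by blast
  next
    assume ?R
    then obtain m N q where q: "\<And>j::nat. q j \<in> rat_times" "\<And>j. q j \<le> real N"
      "\<And>j. k (f (q j)) < inverse (Suc j)"
      "\<And>j s. s \<in> rat_times \<Longrightarrow> s \<le> q j \<Longrightarrow> inverse (Suc m) \<le> g (f s)" by metis
    have ge: "inverse (Suc m) \<le> g (f s)" if "s \<in> {0..q j}" for s j
      using lower_bound_rat_times[OF gf, of "q j" "inverse (Suc m)" s] q(1)[of j] q(4)[of _ j] that
        rat_times_nonneg[of "q j"] by (cases "s = q j") auto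
    have "\<And>j. q j \<in> {0..real N}" using q(1,2) by (auto simp: rat_times_def)
    then obtain t r where t: "t \<in> {0..real N}" and r: "strict_mono r" "(q \<circ> r) \<longlonglongrightarrow> t"
      using compact_Icc[of 0 "real N"] unfolding compact_def by metis
    have lim: "(\<lambda>j. \<phi> (q (r j))) \<longlonglongrightarrow> \<phi> t" if "continuous_on {0..} \<phi>" for \<phi> :: "real \<Rightarrow> real"
    proof -
      have "((\<lambda>j. \<phi> ((q \<circ> r) j)) \<longlongrightarrow> \<phi> t) sequentially"
        by (rule continuous_on_tendsto_compose[OF that r(2)])
          (use t q(1) rat_times_nonneg in auto)
      then show ?thesis by simp
    qed
    have "k (f t) \<le> 0"
    proof (rule LIMSEQ_le[OF lim[OF kf] LIMSEQ_inverse_real_of_nat])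
      have "k (f (q (r j))) \<le> inverse (real (Suc j))" for j
      proof -
        have "inverse (real (Suc (r j))) \<le> inverse (real (Suc j))"
          using seq_suble[OF r(1), of j] by (intro le_imp_inverse_le) auto
        then show ?thesis using q(3)[of "r j"] by linarith
      qed
      then show "\<exists>N. \<forall>n\<ge>N. k (f (q (r n))) \<le> inverse (real (Suc n))" by auto
    qed
    then have F: "f t \<in> F" using k(2)[of "f t"] k(3) by auto
    have gq: "inverse (Suc m) \<le> g (f (q (r j)))" for j
      using ge[of "q (r j)" "r j"] q(1) rat_times_nonneg by auto
    have gt: "inverse (Suc m) \<le> g (f t)"
      by (rule LIMSEQ_le_const[OF lim[OF gf]]) (use gq in blast)
    have "f s \<in> U" if s: "s \<in> {0..t}" for s
    proof -
      have "inverse (Suc m) \<le> g (f s)"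
      proof (cases "s = t")
        case False
        then have "s < t" using s by auto
        then obtain j where "s < (q \<circ> r) j"
          using order_tendstoD(1)[OF r(2)] eventually_happens[of _ sequentially] by fastforce
        then show ?thesis using ge[of s "r j"] s by auto
      qed (use gt in auto)
      moreover have "0 < inverse (real (Suc m))" by simp
      ultimately show ?thesis unfolding g(2) by linarith
    qed
    then show ?L unfolding hits_def using F t by (intro exI[of _ t]) auto
  }
qed

text \<open>
  As long as \<open>U - B\<close> has not been left, the past of the path is irrelevant for hitting \<open>B\<close> before leaving
  \<open>U\<close>.
\<close>

lemma hits_shift:
  assumes "0 \<le> t" "\<And>s. s \<in> {0..t} \<Longrightarrow> f s \<in> U - B"
  shows "hits U B (\<lambda>s. f (t + s)) \<longleftrightarrow> hits U B f"
proof
  assume "hits U B (\<lambda>s. f (t + s))"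
  then obtain u where u: "u \<ge> 0" "f (t + u) \<in> B" "\<And>s. s \<in> {0..u} \<Longrightarrow> f (t + s) \<in> U"
    by (auto simp: hits_def)
  have "f s \<in> U" if "s \<in> {0..t+u}" for s
    using assms(2)[of s] u(3)[of "s - t"] that by (cases "s \<le> t") auto
  then show "hits U B f" using u assms(1) unfolding hits_def by (intro exI[of _ "t+u"]) auto
next
  assume "hits U B f"
  then obtain u where u: "u \<ge> 0" "f u \<in> B" "\<And>s. s \<in> {0..u} \<Longrightarrow> f s \<in> U"
    by (auto simp: hits_def)
  have "t < u" using assms(2)[of u] u by force
  then show "hits U B (\<lambda>s. f (t + s))"
    unfolding hits_def using u assms(1) by (intro exI[of _ "u-t"]) auto
qed

abbreviation "path_space \<equiv> Pi\<^sub>M rat_times (\<lambda>_. borel)"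

text \<open>
  A measurable set of rational-time paths that represents the hitting event for continuous paths. The
  behaviour of \<open>C\<close> on traces of discontinuous paths is left open; all sample paths are continuous.
\<close>

definition codes_hitting :: "(real \<Rightarrow> 'a::topological_space) set \<Rightarrow> 'a set \<Rightarrow> 'a set \<Rightarrow> bool"
  where "codes_hitting C U B \<longleftrightarrow> C \<in> sets path_space \<and>
    (\<forall>f. continuous_on {0..} f \<longrightarrow> (restrict f rat_times \<in> C \<longleftrightarrow> hits U B f))"

lemma codes_hitting_exists:
  fixes U B :: "'a::metric_space set"
  assumes U: "open U" and B: "closedin (top_of_set U) B"
  obtains C where "codes_hitting C U B"
proof -
  obtain F where F: "closed F" "B = U \<inter> F" using B by (auto simp: closedin_closed)
  obtain g where g: "continuous_on UNIV g" "\<And>x. x \<in> U \<longleftrightarrow> 0 < (g x :: real)"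
    using open_eq_positivity_set[OF U] by metis
  have "open (- F)" using F by auto
  then obtain k where k: "continuous_on UNIV k" "\<And>x. 0 \<le> (k x::real)" "\<And>x. x \<in> - F \<longleftrightarrow> 0 < k x"
    using open_eq_positivity_set by metis
  have k3: "x \<in> F \<longleftrightarrow> k x = 0" for x using k(2,3)[of x] by (cases "x \<in> F") auto
  have [measurable]: "g \<in> borel_measurable borel" "k \<in> borel_measurable borel"
    using g(1) k(1) by (auto intro: borel_measurable_continuous_onI)
  note [simp] = countable_rat_times
  define C where "C = {w \<in> space path_space. \<exists>m N::nat. \<forall>j::nat. \<exists>q\<in>rat_times. q \<le> real N \<and>
     k (w q) < inverse (Suc j) \<and> (\<forall>s\<in>rat_times. s \<le> q \<longrightarrow> inverse (Suc m) \<le> g (w s))}"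
  show ?thesis
  proof (rule that[of C], unfold codes_hitting_def, intro conjI allI impI)
    show "C \<in> sets path_space" unfolding C_def by measurable
    fix f :: "real \<Rightarrow> 'a" assume f: "continuous_on {0..} f"
    show "restrict f rat_times \<in> C \<longleftrightarrow> hits U B f"
      unfolding F(2) hits_iff_rat_times[OF f g k(1,2) k3] C_def by (simp add: space_PiM cong: conj_cong)
  qed
qed

section \<open>The past of a process and the one-step Markov property\<close>

definition past :: "'w measure \<Rightarrow> (real \<Rightarrow> 'w \<Rightarrow> 'a::topological_space) \<Rightarrow> real \<Rightarrow> 'w measure"
  where "past M X s = sigma (space M) {X u -` S \<inter> space M | u S. 0 \<le> u \<and> u \<le> s \<and> S \<in> sets borel}"

lemma space_past [simp]: "space (past M X s) = space M"
  unfolding past_def by (rule space_measure_of) auto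

lemma sets_past: "sets (past M X s) =
    sigma_sets (space M) {X u -` S \<inter> space M | u S. 0 \<le> u \<and> u \<le> s \<and> S \<in> sets borel}"
  unfolding past_def by (rule sets_measure_of) auto

lemma past_component: "0 \<le> u \<Longrightarrow> u \<le> s \<Longrightarrow> X u \<in> past M X s \<rightarrow>\<^sub>M borel"
  by (rule measurableI) (auto simp: sets_past intro!: sigma_sets.Basic)

lemma past_mono: "s \<le> t \<Longrightarrow> sets (past M X s) \<subseteq> sets (past M X t)"
  unfolding sets_past by (rule sigma_sets_mono') force

lemma sets_past_subset:
  assumes "\<And>t. 0 \<le> t \<Longrightarrow> X t \<in> borel_measurable M"
  shows "sets (past M X s) \<subseteq> sets M"
  unfolding sets_past using assms by (intro sets.sigma_sets_subset) (auto intro: measurable_sets)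

text \<open>
  The Gaussian density of an increment over a time span \<open>r\<close>; its continuity in \<open>z\<close> is the source of the
  semicontinuity of hitting probabilities.
\<close>

definition heat :: "real \<Rightarrow> real ^ 'n \<Rightarrow> ennreal"
  where "heat r z = ennreal ((2 * pi * r) powr (- real CARD('n) / 2) * exp (- (norm z)\<^sup>2 / (2 * r)))"

lemma heat_measurable [measurable]: "heat r \<in> borel_measurable borel"
  unfolding heat_def by measurable

lemma
  assumes "brownian_motion M X x"
  shows brownian_motion_prob_space: "prob_space M"
    and brownian_motion_measurable: "0 \<le> t \<Longrightarrow> X t \<in> borel_measurable M"
    and brownian_motion_continuous: "\<omega> \<in> space M \<Longrightarrow> continuous_on {0..} (\<lambda>t. X t \<omega>)"
    and brownian_motion_start: "AE \<omega> in M. X 0 \<omega> = x"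
    and brownian_motion_indep: "0 \<le> s \<Longrightarrow> s < t \<Longrightarrow> prob_space.indep_set M
        (sets (past M X s)) {(\<lambda>\<omega>. X t \<omega> - X s \<omega>) -` S \<inter> space M | S. S \<in> sets borel}"
    and brownian_motion_increment: "0 \<le> s \<Longrightarrow> s < t \<Longrightarrow>
        distributed M lborel (\<lambda>\<omega>. X t \<omega> - X s \<omega>) (heat (t - s))"
  using assms unfolding brownian_motion_def sets_past heat_def[abs_def] by auto

text \<open>
  Independence says that the past and the increment have a product law as a pair, so Fubini's theorem
  integrates out the increment with the position at time \<open>s\<close> held fixed.
\<close>

lemma brownian_one_step:
  fixes X :: "real \<Rightarrow> 'w \<Rightarrow> real ^ 'n"
  assumes bm: "brownian_motion M X x" and st: "0 \<le> s" "s < t"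
    and E: "E \<in> sets (past M X s)" and f [measurable]: "f \<in> borel_measurable borel"
  shows "(\<integral>\<^sup>+\<omega>. indicator E \<omega> * f (X t \<omega>) \<partial>M) =
    (\<integral>\<^sup>+\<omega>. indicator E \<omega> * (\<integral>\<^sup>+z. heat (t - s) z * f (X s \<omega> + z) \<partial>lborel) \<partial>M)"
proof -
  interpret prob_space M using bm by (rule brownian_motion_prob_space)
  note Xm = brownian_motion_measurable[OF bm]
  define N where "N = past M X s"
  define inc where "inc = (\<lambda>\<omega>. X t \<omega> - X s \<omega>)"
  have [measurable]: "X s \<in> borel_measurable M" "X t \<in> borel_measurable M" "inc \<in> borel_measurable M"
    using Xm st by (auto simp: inc_def)
  have NX [measurable]: "X s \<in> N \<rightarrow>\<^sub>M borel" unfolding N_def using st by (intro past_component) auto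
  have EN [measurable]: "E \<in> sets N" using E by (simp add: N_def)
  have subN: "sets N \<subseteq> sets M" unfolding N_def by (rule sets_past_subset) (use Xm in auto)
  have EM [measurable]: "E \<in> sets M" using subN EN by auto
  have idN [measurable]: "(\<lambda>\<omega>. \<omega>) \<in> M \<rightarrow>\<^sub>M N"
    using subN sets.sets_into_space[of _ M] by (intro measurableI) (auto simp: N_def Int_absorb2 subset_eq)
  have indep: "indep_set (sets N) {inc -` S \<inter> space M |S. S \<in> sets borel}"
    using brownian_motion_indep[OF bm st] by (simp add: N_def inc_def)
  \<comment> \<open>The first coordinate lives on the space \<open>N\<close> that carries only the past up to time \<open>s\<close>.\<close>
  have joint: "distr M (N \<Otimes>\<^sub>M borel) (\<lambda>\<omega>. (\<omega>, inc \<omega>)) = distr M N (\<lambda>\<omega>. \<omega>) \<Otimes>\<^sub>M distr M borel inc"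
  proof (rule pair_measure_eqI[symmetric])
    show "sigma_finite_measure (distr M N (\<lambda>\<omega>. \<omega>))" "sigma_finite_measure (distr M borel inc)"
      by (auto intro!: prob_space_imp_sigma_finite prob_space_distr)
    fix A S assume "A \<in> sets (distr M N (\<lambda>\<omega>. \<omega>))" "S \<in> sets (distr M borel inc)"
    then have A [measurable]: "A \<in> sets N" and S [measurable]: "S \<in> sets borel" by auto
    have AM: "A \<in> sets M" using A subN by auto
    have SM: "inc -` S \<inter> space M \<in> sets M" by measurable
    have "emeasure (distr M (N \<Otimes>\<^sub>M borel) (\<lambda>\<omega>. (\<omega>, inc \<omega>))) (A \<times> S) = emeasure M (A \<inter> (inc -` S \<inter> space M))"
      by (subst emeasure_distr) (auto intro!: arg_cong[where f="emeasure M"])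
    also have "\<dots> = emeasure M A * emeasure M (inc -` S \<inter> space M)"
    proof -
      have "prob (A \<inter> (inc -` S \<inter> space M)) = prob A * prob (inc -` S \<inter> space M)"
        using indep S A unfolding indep_sets2_eq by blast
      then show ?thesis by (simp add: emeasure_eq_measure ennreal_mult measure_nonneg)
    qed
    also have "\<dots> = emeasure (distr M N (\<lambda>\<omega>. \<omega>)) A * emeasure (distr M borel inc) S"
      using AM sets.sets_into_space[OF AM] by (simp add: emeasure_distr Int_absorb2 vimage_def)
    finally show "emeasure (distr M N (\<lambda>\<omega>. \<omega>)) A * emeasure (distr M borel inc) S =
      emeasure (distr M (N \<Otimes>\<^sub>M borel) (\<lambda>\<omega>. (\<omega>, inc \<omega>))) (A \<times> S)" by simp
  qed (simp cong: sets_pair_measure_cong)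
  interpret I: prob_space "distr M borel inc" by (rule prob_space_distr) measurable
  have dist: "distributed M lborel inc (heat (t - s))"
    unfolding inc_def by (rule brownian_motion_increment[OF bm st])
  have inner: "(\<integral>\<^sup>+z. f (X s \<omega> + z) \<partial>distr M borel inc) =
      (\<integral>\<^sup>+z. heat (t - s) z * f (X s \<omega> + z) \<partial>lborel)" for \<omega>
  proof -
    have "(\<integral>\<^sup>+z. f (X s \<omega> + z) \<partial>distr M borel inc) = (\<integral>\<^sup>+\<omega>'. f (X s \<omega> + inc \<omega>') \<partial>M)"
      by (rule nn_integral_distr) measurable
    also have "\<dots> = (\<integral>\<^sup>+z. heat (t - s) z * f (X s \<omega> + z) \<partial>lborel)"
      by (rule distributed_nn_integral[OF dist, symmetric]) measurable
    finally show ?thesis .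
  qed
  define F where "F = (\<lambda>(\<omega>, z). indicator E \<omega> * f (X s \<omega> + z))"
  have F [measurable]: "F \<in> borel_measurable (N \<Otimes>\<^sub>M borel)" unfolding F_def by measurable
  have F': "F \<in> borel_measurable (distr M N (\<lambda>\<omega>. \<omega>) \<Otimes>\<^sub>M distr M borel inc)"
    using F by (simp cong: measurable_cong_sets sets_pair_measure_cong)
  have "(\<integral>\<^sup>+\<omega>. indicator E \<omega> * f (X t \<omega>) \<partial>M) = (\<integral>\<^sup>+\<omega>. F (\<omega>, inc \<omega>) \<partial>M)"
    by (simp add: F_def inc_def)
  also have "\<dots> = (\<integral>\<^sup>+p. F p \<partial>distr M (N \<Otimes>\<^sub>M borel) (\<lambda>\<omega>. (\<omega>, inc \<omega>)))"
    by (rule nn_integral_distr[symmetric]) measurable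
  also have "\<dots> = (\<integral>\<^sup>+\<omega>. \<integral>\<^sup>+z. F (\<omega>, z) \<partial>distr M borel inc \<partial>distr M N (\<lambda>\<omega>. \<omega>))"
    unfolding joint by (rule I.nn_integral_fst[OF F', symmetric])
  also have "\<dots> = (\<integral>\<^sup>+\<omega>. \<integral>\<^sup>+z. F (\<omega>, z) \<partial>distr M borel inc \<partial>M)"
    by (rule nn_integral_distr) measurable
  also have "\<dots> = (\<integral>\<^sup>+\<omega>. indicator E \<omega> * (\<integral>\<^sup>+z. f (X s \<omega> + z) \<partial>distr M borel inc) \<partial>M)"
    by (intro nn_integral_cong) (simp add: F_def nn_integral_cmult)
  finally show ?thesis unfolding inner .
qed

text \<open>
  The probability that a Brownian motion at \<open>x\<close> at time \<open>s\<close> satisfies all constraints \<open>X\<^sub>t \<in> S\<close> in the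
  time-ordered list. The case \<open>t \<le> s\<close> is read as a constraint on the current position, so that the
  time \<open>s\<close> itself is allowed.
\<close>

primrec cylinder_kernel :: "real \<Rightarrow> real ^ 'n \<Rightarrow> (real \<times> (real ^ 'n) set) list \<Rightarrow> ennreal" where
  "cylinder_kernel s x [] = 1"
| "cylinder_kernel s x (p # L) =
    (if fst p \<le> s then indicator (snd p) x * cylinder_kernel s x L
     else \<integral>\<^sup>+z. heat (fst p - s) z * (indicator (snd p) (x + z) * cylinder_kernel (fst p) (x + z) L) \<partial>lborel)"

lemma cylinder_kernel_measurable:
  "(\<And>t S. (t, S) \<in> set L \<Longrightarrow> S \<in> sets borel) \<Longrightarrow>
    (\<lambda>x. cylinder_kernel s x L) \<in> borel_measurable borel"
proof (induction L arbitrary: s)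
  case (Cons p L)
  obtain t S where p: "p = (t, S)" by (cases p)
  have [measurable]: "S \<in> sets borel" using Cons.prems p by auto
  have [measurable]: "(\<lambda>x. cylinder_kernel s x L) \<in> borel_measurable borel" for s
    using Cons by auto
  show ?case unfolding p cylinder_kernel.simps fst_conv snd_conv by measurable
qed simp

lemma cylinder_kernel_shift:
  "cylinder_kernel (a + s) x (map (\<lambda>(t, S). (a + t, S)) L) = cylinder_kernel s x L"
proof (induction L arbitrary: s x)
  case (Cons p L)
  then show ?case by (cases p) simp
qed simp

text \<open>
  The Markov property for finitely many observation times: each constraint \<open>X\<^sub>t \<in> S\<close> is absorbed into
  the event of the past, and then the one-step property moves back from time \<open>t\<close> to time \<open>s\<close>.
\<close>

lemma markov_cylinder:
  fixes X :: "real \<Rightarrow> 'w \<Rightarrow> real ^ 'n"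
  assumes bm: "brownian_motion M X x" and "0 \<le> s" and "E \<in> sets (past M X s)"
    and "\<And>t S. (t, S) \<in> set L \<Longrightarrow> s \<le> t \<and> S \<in> sets borel" and "sorted (map fst L)"
  shows "emeasure M (E \<inter> {\<omega>\<in>space M. \<forall>(t, S)\<in>set L. X t \<omega> \<in> S}) =
    (\<integral>\<^sup>+\<omega>. indicator E \<omega> * cylinder_kernel s (X s \<omega>) L \<partial>M)"
  using assms(2-)
proof (induction L arbitrary: s E)
  case Nil
  have "E \<in> sets M"
    by (rule subsetD[OF sets_past_subset Nil(2)]) (rule brownian_motion_measurable[OF bm])
  then show ?case using sets.sets_into_space[of E M] by (simp add: Int_absorb2)
next
  case (Cons p L)
  obtain t S where p: "p = (t, S)" by (cases p)
  have st: "s \<le> t" and S [measurable]: "S \<in> sets borel" using Cons.prems(3)[of t S] p by auto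
  have km [measurable]: "(\<lambda>x. cylinder_kernel s x L) \<in> borel_measurable borel" for s
    using Cons.prems by (intro cylinder_kernel_measurable) auto
  define E' where "E' = E \<inter> (X t -` S \<inter> space M)"
  have "X t -` S \<inter> space M \<in> sets (past M X t)"
    using measurable_sets[OF past_component[of t t X M], of S] st Cons.prems(1) by simp
  then have E': "E' \<in> sets (past M X t)"
    using past_mono[OF st] Cons.prems(2) unfolding E'_def by blast
  have "E \<inter> {\<omega>\<in>space M. \<forall>(t, S)\<in>set (p # L). X t \<omega> \<in> S} =
      E' \<inter> {\<omega>\<in>space M. \<forall>(t, S)\<in>set L. X t \<omega> \<in> S}"
    unfolding E'_def p by auto
  also have "emeasure M \<dots> = (\<integral>\<^sup>+\<omega>. indicator E' \<omega> * cylinder_kernel t (X t \<omega>) L \<partial>M)"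
    using Cons.prems st E' by (intro Cons.IH) (auto simp: p)
  also have "\<dots> = (\<integral>\<^sup>+\<omega>. indicator E \<omega> * (indicator S (X t \<omega>) * cylinder_kernel t (X t \<omega>) L) \<partial>M)"
    by (intro nn_integral_cong) (auto simp: E'_def indicator_def)
  also have "\<dots> = (\<integral>\<^sup>+\<omega>. indicator E \<omega> * cylinder_kernel s (X s \<omega>) (p # L) \<partial>M)"
  proof (cases "s = t")
    case False
    then have "s < t" using st by auto
    then show ?thesis unfolding p
      by (subst brownian_one_step[OF bm Cons.prems(1) \<open>s < t\<close> Cons.prems(2)]) auto
  qed (simp add: p)
  finally show ?case .
qed

section \<open>The Markov property on path space\<close>

text \<open>
  The trajectory after time \<open>t\<close>, recorded at rational delays only, so that countable operations on
  coordinates stay measurable; by continuity nothing is lost.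
\<close>

definition rat_path :: "(real \<Rightarrow> 'w \<Rightarrow> 'a) \<Rightarrow> real \<Rightarrow> 'w \<Rightarrow> real \<Rightarrow> 'a"
  where "rat_path Z t \<omega> = (\<lambda>q\<in>rat_times. Z (t + q) \<omega>)"

definition path_law :: "('a \<Rightarrow> 'w measure) \<Rightarrow> (real \<Rightarrow> 'w \<Rightarrow> 'a) \<Rightarrow> (real \<Rightarrow> 'a) set \<Rightarrow> 'a \<Rightarrow> ennreal"
  where "path_law P X C x = emeasure (P x) {\<omega>\<in>space (P x). rat_path X 0 \<omega> \<in> C}"

lemma rat_path_measurable [measurable (raw)]:
  assumes "\<And>t. 0 \<le> t \<Longrightarrow> Z t \<in> borel_measurable M" "0 \<le> t"
  shows "rat_path Z t \<in> M \<rightarrow>\<^sub>M path_space"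
  unfolding rat_path_def[abs_def]
  by (rule measurable_restrict) (use assms rat_times_nonneg in auto)

lemma rat_path_in_cylinder:
  assumes "finite J" "J \<subseteq> rat_times"
  shows "rat_path Z t \<omega> \<in> prod_emb rat_times (\<lambda>_. borel) J (Pi\<^sub>E J E) \<longleftrightarrow>
    (\<forall>(u, S)\<in>set (map (\<lambda>(u, S). (t + u, S)) (map (\<lambda>j. (j, E j)) (sorted_list_of_set J))). Z u \<omega> \<in> S)"
proof -
  have "rat_path Z t \<omega> \<in> prod_emb rat_times (\<lambda>_. borel) J (Pi\<^sub>E J E) \<longleftrightarrow> (\<forall>j\<in>J. Z (t + j) \<omega> \<in> E j)"
    using assms(2) unfolding prod_emb_def rat_path_def
    by (fastforce simp: PiE_iff restrict_def extensional_def)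
  then show ?thesis using assms(1) by auto
qed

lemma brownian_familyD: "brownian_family P X \<Longrightarrow> brownian_motion (P x) X x"
  by (auto simp: brownian_family_def)

lemma path_law_cylinder:
  fixes X :: "real \<Rightarrow> 'w \<Rightarrow> real ^ 'n"
  assumes fam: "brownian_family P X" and J: "finite J" "J \<subseteq> rat_times" "\<And>j. j \<in> J \<Longrightarrow> E j \<in> sets borel"
  shows "path_law P X (prod_emb rat_times (\<lambda>_. borel) J (Pi\<^sub>E J E)) x =
    cylinder_kernel 0 x (map (\<lambda>j. (j, E j)) (sorted_list_of_set J))" (is "_ = cylinder_kernel 0 x ?L")
proof -
  note bm = brownian_familyD[OF fam, of x]
  interpret prob_space "P x" using bm by (rule brownian_motion_prob_space)
  have "path_law P X (prod_emb rat_times (\<lambda>_. borel) J (Pi\<^sub>E J E)) x =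
     emeasure (P x) (space (P x) \<inter> {\<omega>\<in>space (P x). \<forall>(u, S)\<in>set ?L. X u \<omega> \<in> S})"
    unfolding path_law_def rat_path_in_cylinder[OF J(1,2)] by (auto intro!: arg_cong[where f="emeasure (P x)"])
  also have "\<dots> = (\<integral>\<^sup>+\<omega>. indicator (space (P x)) \<omega> * cylinder_kernel 0 (X 0 \<omega>) ?L \<partial>P x)"
  proof (rule markov_cylinder[OF bm])
    show "space (P x) \<in> sets (past (P x) X 0)"
      by (metis sets.top space_past)
    show "0 \<le> t \<and> S \<in> sets borel" if "(t, S) \<in> set ?L" for t S
      using that J rat_times_nonneg by auto
  qed (auto simp: comp_def)
  also have "\<dots> = (\<integral>\<^sup>+\<omega>. cylinder_kernel 0 x ?L \<partial>P x)"
    using brownian_motion_start[OF bm] by (intro nn_integral_cong_AE) auto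
  finally show ?thesis by (simp add: emeasure_space_1)
qed

text \<open>
  The Markov property extends from cylinders to all path events by a Dynkin argument; measurability of
  \<open>x \<mapsto> P\<^sup>x(C)\<close> is carried along, since the right-hand side makes sense only with it. The process \<open>Z\<close>
  and the family \<open>X\<close> are unrelated: this also identifies the law of any Brownian motion, in particular
  of a translated one.
\<close>

lemma markov_path_aux:
  fixes X :: "real \<Rightarrow> 'w \<Rightarrow> real ^ 'n" and Z :: "real \<Rightarrow> 'v \<Rightarrow> real ^ 'n"
  assumes fam: "brownian_family P X" and bm: "brownian_motion M Z z"
    and t: "0 \<le> t" and E: "E \<in> sets (past M Z t)" and C: "C \<in> sets path_space"
  shows "path_law P X C \<in> borel_measurable borel \<and>
    emeasure M (E \<inter> {\<omega>\<in>space M. rat_path Z t \<omega> \<in> C}) =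
      (\<integral>\<^sup>+\<omega>. indicator E \<omega> * path_law P X C (Z t \<omega>) \<partial>M)"
proof -
  interpret prob_space M using bm by (rule brownian_motion_prob_space)
  have Px: "prob_space (P x)" for x by (rule brownian_motion_prob_space[OF brownian_familyD[OF fam]])
  note Zm = brownian_motion_measurable[OF bm]
  note Xm = brownian_motion_measurable[OF brownian_familyD[OF fam]]
  have [measurable]: "Z t \<in> borel_measurable M" using Zm t by auto
  have EM [measurable]: "E \<in> sets M" by (rule subsetD[OF sets_past_subset E]) (rule Zm)
  have ev: "{\<omega>\<in>space M. rat_path Z t \<omega> \<in> C} \<in> sets M" if "C \<in> sets path_space" for C
    using measurable_sets[OF rat_path_measurable[OF Zm t] that] by (simp add: vimage_def Int_def conj_commute)
  have evP: "{\<omega>\<in>space (P x). rat_path X 0 \<omega> \<in> C} \<in> sets (P x)" if "C \<in> sets path_space" for C x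
    using measurable_sets[OF rat_path_measurable[OF Xm order_refl] that] by (simp add: vimage_def Int_def conj_commute)
  show ?thesis
    using Int_stable_prod_algebra prod_algebra_sets_into_space C[unfolded sets_PiM]
  proof (induction rule: sigma_sets_induct_disjoint)
    case (basic A)
    then obtain J F where A: "A = prod_emb rat_times (\<lambda>_. borel) J (Pi\<^sub>E J F)"
      and J: "finite J" "J \<subseteq> rat_times" "\<And>i. i \<in> J \<Longrightarrow> F i \<in> sets borel"
      by (rule prod_algebraE) auto
    define L where "L = map (\<lambda>j. (j, F j)) (sorted_list_of_set J)"
    have law: "path_law P X A x = cylinder_kernel 0 x L" for x
      unfolding A L_def by (rule path_law_cylinder[OF fam J])
    have "(\<lambda>x. cylinder_kernel 0 x L) \<in> borel_measurable borel"
      by (rule cylinder_kernel_measurable) (use J in \<open>auto simp: L_def\<close>)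
    moreover have "emeasure M (E \<inter> {\<omega>\<in>space M. rat_path Z t \<omega> \<in> A}) =
        (\<integral>\<^sup>+\<omega>. indicator E \<omega> * cylinder_kernel t (Z t \<omega>) (map (\<lambda>(u, S). (t + u, S)) L) \<partial>M)"
      unfolding A rat_path_in_cylinder[OF J(1,2)] L_def[symmetric]
    proof (rule markov_cylinder[OF bm t E])
      show "t \<le> u \<and> S \<in> sets borel" if "(u, S) \<in> set (map (\<lambda>(u, S). (t + u, S)) L)" for u S
        using that J rat_times_nonneg by (auto simp: L_def)
      show "sorted (map fst (map (\<lambda>(u, S). (t + u, S)) L))"
        unfolding L_def by (auto simp: comp_def sorted_map intro!: sorted_wrt_mono_rel[OF _ sorted_sorted_list_of_set])
    qed
    ultimately show ?case
      using cylinder_kernel_shift[of t 0 _ L] unfolding law[abs_def] by simp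
  next
    case empty
    show ?case by (simp add: path_law_def[abs_def])
  next
    case (compl A)
    have A: "A \<in> sets path_space" using compl(1) by (simp add: sets_PiM)
    have IH [measurable]: "path_law P X A \<in> borel_measurable borel" using compl(2) by simp
    have c: "path_law P X ((\<Pi>\<^sub>E i\<in>rat_times. space borel) - A) = (\<lambda>x. 1 - path_law P X A x)"
    proof
      fix x
      interpret Px: prob_space "P x" by (rule Px)
      have "{\<omega>\<in>space (P x). rat_path X 0 \<omega> \<in> (\<Pi>\<^sub>E i\<in>rat_times. space borel) - A} =
          space (P x) - {\<omega>\<in>space (P x). rat_path X 0 \<omega> \<in> A}"
        by (auto simp: rat_path_def)
      then show "path_law P X ((\<Pi>\<^sub>E i\<in>rat_times. space borel) - A) x = 1 - path_law P X A x"
        unfolding path_law_def using evP[OF A, of x]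
        by (simp add: emeasure_compl Px.emeasure_space_1)
    qed
    have le1: "path_law P X A x \<le> 1" for x
      unfolding path_law_def by (rule prob_space.emeasure_le_1[OF Px])
    have "E \<inter> {\<omega>\<in>space M. rat_path Z t \<omega> \<in> (\<Pi>\<^sub>E i\<in>rat_times. space borel) - A} =
        E - (E \<inter> {\<omega>\<in>space M. rat_path Z t \<omega> \<in> A})"
      using sets.sets_into_space[OF EM] by (auto simp: rat_path_def)
    then have "emeasure M (E \<inter> {\<omega>\<in>space M. rat_path Z t \<omega> \<in> (\<Pi>\<^sub>E i\<in>rat_times. space borel) - A}) =
        emeasure M E - emeasure M (E \<inter> {\<omega>\<in>space M. rat_path Z t \<omega> \<in> A})"
      using ev[OF A] by (simp add: emeasure_Diff)
    also have "\<dots> = (\<integral>\<^sup>+\<omega>. indicator E \<omega> \<partial>M) - (\<integral>\<^sup>+\<omega>. indicator E \<omega> * path_law P X A (Z t \<omega>) \<partial>M)"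
      using compl(2) by simp
    also have "\<dots> = (\<integral>\<^sup>+\<omega>. indicator E \<omega> - indicator E \<omega> * path_law P X A (Z t \<omega>) \<partial>M)"
    proof (rule nn_integral_diff[symmetric])
      have "(\<integral>\<^sup>+\<omega>. indicator E \<omega> * path_law P X A (Z t \<omega>) \<partial>M) \<le> (\<integral>\<^sup>+\<omega>. indicator E \<omega> \<partial>M)"
        using le1 by (intro nn_integral_mono) (auto simp: indicator_def)
      then show "(\<integral>\<^sup>+\<omega>. indicator E \<omega> * path_law P X A (Z t \<omega>) \<partial>M) \<noteq> \<infinity>"
        by (auto simp: top_unique)
    qed (use le1 in \<open>auto simp: indicator_def\<close>)
    also have "\<dots> = (\<integral>\<^sup>+\<omega>. indicator E \<omega> * (1 - path_law P X A (Z t \<omega>)) \<partial>M)"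
      by (intro nn_integral_cong) (auto simp: indicator_def)
    finally show ?case unfolding c by simp
  next
    case (union A)
    have A: "A i \<in> sets path_space" for i using union(2) by (auto simp: sets_PiM)
    have IH [measurable]: "path_law P X (A i) \<in> borel_measurable borel" for i using union(3) by simp
    have dj: "i = j" if "w \<in> A i" "w \<in> A j" for i j w
      using union(1) that unfolding disjoint_family_on_def by blast
    have c: "path_law P X (\<Union>i. A i) = (\<lambda>x. \<Sum>i. path_law P X (A i) x)"
    proof
      fix x
      have "{\<omega>\<in>space (P x). rat_path X 0 \<omega> \<in> (\<Union>i. A i)} = (\<Union>i. {\<omega>\<in>space (P x). rat_path X 0 \<omega> \<in> A i})"
        by auto
      also have "emeasure (P x) \<dots> = (\<Sum>i. path_law P X (A i) x)"
        unfolding path_law_def using evP[OF A]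
        by (intro suminf_emeasure[symmetric]) (auto simp: disjoint_family_on_def dest: dj)
      finally show "path_law P X (\<Union>i. A i) x = (\<Sum>i. path_law P X (A i) x)"
        by (simp add: path_law_def)
    qed
    have "E \<inter> {\<omega>\<in>space M. rat_path Z t \<omega> \<in> (\<Union>i. A i)} =
        (\<Union>i. E \<inter> {\<omega>\<in>space M. rat_path Z t \<omega> \<in> A i})" by auto
    also have "emeasure M \<dots> = (\<Sum>i. emeasure M (E \<inter> {\<omega>\<in>space M. rat_path Z t \<omega> \<in> A i}))"
      using ev[OF A]
      by (intro suminf_emeasure[symmetric]) (auto simp: disjoint_family_on_def dest: dj)
    also have "\<dots> = (\<Sum>i. \<integral>\<^sup>+\<omega>. indicator E \<omega> * path_law P X (A i) (Z t \<omega>) \<partial>M)"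
      using union(3) by simp
    also have "\<dots> = (\<integral>\<^sup>+\<omega>. (\<Sum>i. indicator E \<omega> * path_law P X (A i) (Z t \<omega>)) \<partial>M)"
      by (rule nn_integral_suminf[symmetric]) measurable
    finally show ?case unfolding c by simp
  qed
qed

lemma path_law_measurable:
  fixes X :: "real \<Rightarrow> 'w \<Rightarrow> real ^ 'n"
  assumes fam: "brownian_family P X" and C: "C \<in> sets path_space"
  shows "path_law P X C \<in> borel_measurable borel"
  by (rule conjunct1[OF markov_path_aux[OF fam brownian_familyD[OF fam] order_refl sets.empty_sets C]])

lemmas markov_path = conjunct2[OF markov_path_aux]

lemma law_from_start:
  fixes X :: "real \<Rightarrow> 'w \<Rightarrow> real ^ 'n" and Z :: "real \<Rightarrow> 'v \<Rightarrow> real ^ 'n"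
  assumes fam: "brownian_family P X" and bm: "brownian_motion M Z z" and C: "C \<in> sets path_space"
  shows "emeasure M {\<omega>\<in>space M. rat_path Z 0 \<omega> \<in> C} = path_law P X C z"
proof -
  interpret prob_space M using bm by (rule brownian_motion_prob_space)
  have "emeasure M (space M \<inter> {\<omega>\<in>space M. rat_path Z 0 \<omega> \<in> C}) =
      (\<integral>\<^sup>+\<omega>. indicator (space M) \<omega> * path_law P X C (Z 0 \<omega>) \<partial>M)"
    by (rule markov_path[OF fam bm order_refl _ C]) (metis sets.top space_past)
  also have "\<dots> = (\<integral>\<^sup>+\<omega>. path_law P X C z \<partial>M)"
    using brownian_motion_start[OF bm] by (intro nn_integral_cong_AE) auto
  finally show ?thesis by (simp add: emeasure_space_1 Int_def)
qed

lemma brownian_motion_translate: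
  fixes X :: "real \<Rightarrow> 'w \<Rightarrow> real ^ 'n"
  assumes bm: "brownian_motion M X x"
  shows "brownian_motion M (\<lambda>t \<omega>. X t \<omega> - a) (x - a)"
proof -
  have *: "{(\<lambda>\<omega>. X u \<omega> - a) -` S \<inter> space M | u S. 0 \<le> u \<and> u \<le> s \<and> S \<in> sets borel} =
     {X u -` S \<inter> space M | u S. 0 \<le> u \<and> u \<le> s \<and> S \<in> sets borel}" (is "?A = ?B") for s
  proof (intro equalityI subsetI)
    fix W assume "W \<in> ?A"
    then obtain u S where W: "W = (\<lambda>\<omega>. X u \<omega> - a) -` S \<inter> space M" "0 \<le> u" "u \<le> s"
      and [measurable]: "S \<in> sets borel" by auto
    have "W = X u -` ((\<lambda>x. x - a) -` S) \<inter> space M" using W by auto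
    moreover have "(\<lambda>x. x - a) -` S \<in> sets borel"
      using measurable_sets[of "\<lambda>x. x - a" borel borel S] by simp
    ultimately show "W \<in> ?B" using W by blast
  next
    fix W assume "W \<in> ?B"
    then obtain u S where W: "W = X u -` S \<inter> space M" "0 \<le> u" "u \<le> s"
      and [measurable]: "S \<in> sets borel" by auto
    have "W = (\<lambda>\<omega>. X u \<omega> - a) -` ((\<lambda>x. x + a) -` S) \<inter> space M" using W by auto
    moreover have "(\<lambda>x. x + a) -` S \<in> sets borel"
      using measurable_sets[of "\<lambda>x. x + a" borel borel S] by simp
    ultimately show "W \<in> ?A" using W by blast
  qed
  show ?thesis
    using bm unfolding brownian_motion_def * by (auto intro!: continuous_intros)
qed

text \<open>
  Subtracting the starting point turns \<open>P\<^sup>x\<close> into the law from the origin. This makes estimates near the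
  starting point uniform in it.
\<close>

lemma path_law_translate:
  fixes X :: "real \<Rightarrow> 'w \<Rightarrow> real ^ 'n"
  assumes fam: "brownian_family P X" and C: "C \<in> sets path_space"
  shows "emeasure (P x) {\<omega>\<in>space (P x). (\<lambda>q\<in>rat_times. X q \<omega> - x) \<in> C} = path_law P X C 0"
  using law_from_start[OF fam brownian_motion_translate[OF brownian_familyD[OF fam]] C, of x x]
  by (simp add: rat_path_def cong: restrict_cong)

section \<open>Lower semicontinuity of the hitting probability\<close>

text \<open>
  The expectation of \<open>P\<^bsub>X\<^sub>t\<^esub>(C)\<close>, written so that the starting point occurs only in the continuous density.
\<close>

lemma one_step_density:
  fixes X :: "real \<Rightarrow> 'w \<Rightarrow> real ^ 'n"
  assumes fam: "brownian_family P X" and C: "C \<in> sets path_space" and t: "0 < t"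
  shows "emeasure (P x) {\<omega>\<in>space (P x). rat_path X t \<omega> \<in> C} =
    (\<integral>\<^sup>+z. path_law P X C z * heat t (z - x) \<partial>lborel)"
proof -
  note bm = brownian_familyD[OF fam, of x]
  interpret prob_space "P x" using bm by (rule brownian_motion_prob_space)
  note [measurable] = path_law_measurable[OF fam C]
  have sp: "space (P x) \<in> sets (past (P x) X s)" for s by (metis sets.top space_past)
  have "emeasure (P x) (space (P x) \<inter> {\<omega>\<in>space (P x). rat_path X t \<omega> \<in> C}) =
      (\<integral>\<^sup>+\<omega>. indicator (space (P x)) \<omega> * path_law P X C (X t \<omega>) \<partial>P x)"
    by (rule markov_path[OF fam bm _ sp C]) (use t in auto)
  also have "\<dots> = (\<integral>\<^sup>+\<omega>. indicator (space (P x)) \<omega> *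
      (\<integral>\<^sup>+z. heat (t - 0) z * path_law P X C (X 0 \<omega> + z) \<partial>lborel) \<partial>P x)"
    by (rule brownian_one_step[OF bm order_refl t sp]) measurable
  also have "\<dots> = (\<integral>\<^sup>+\<omega>. (\<integral>\<^sup>+z. heat t z * path_law P X C (x + z) \<partial>lborel) \<partial>P x)"
    using brownian_motion_start[OF bm] by (intro nn_integral_cong_AE) auto
  also have "\<dots> = (\<integral>\<^sup>+z. heat t z * path_law P X C (x + z) \<partial>lborel)"
    by (simp add: emeasure_space_1)
  also have "\<dots> = (\<integral>\<^sup>+z. path_law P X C (x + z) * heat t (x + z - x) \<partial>lborel)"
    by (simp add: mult.commute)
  also have "\<dots> = (\<integral>\<^sup>+z. path_law P X C z * heat t (z - x) \<partial>distr lborel borel ((+) x))"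
    by (rule nn_integral_distr[symmetric]) measurable
  finally show ?thesis by (simp add: lborel_distr_plus Int_def)
qed

lemma heat_continuous: "continuous_on UNIV (heat r :: real ^ 'n \<Rightarrow> ennreal)"
proof -
  have "continuous_on UNIV (\<lambda>z :: real ^ 'n. (2 * pi * r) powr (- real CARD('n) / 2) * exp (- (norm z)\<^sup>2 * inverse (2 * r)))"
    by (intro continuous_intros)
  then show ?thesis unfolding heat_def[abs_def] divide_inverse[of _ "2 * r"]
    by (rule continuous_on_ennreal)
qed

lemma path_law_le_1: "brownian_family P X \<Longrightarrow> path_law P X C x \<le> 1"
  unfolding path_law_def
  by (rule prob_space.emeasure_le_1[OF brownian_motion_prob_space[OF brownian_familyD]])

text \<open>
  Fatou's lemma applied to the pointwise convergent densities.
\<close>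

lemma one_step_lsc:
  fixes X :: "real \<Rightarrow> 'w \<Rightarrow> real ^ 'n"
  assumes fam: "brownian_family P X" and C: "C \<in> sets path_space" and x: "x \<longlonglongrightarrow> a"
  shows "(\<integral>\<^sup>+z. path_law P X C z * heat t (z - a) \<partial>lborel) \<le>
    liminf (\<lambda>n. \<integral>\<^sup>+z. path_law P X C z * heat t (z - x n) \<partial>lborel)"
proof -
  note [measurable] = path_law_measurable[OF fam C]
  have "path_law P X C z * heat t (z - a) = liminf (\<lambda>n. path_law P X C z * heat t (z - x n))" for z
  proof (rule lim_imp_Liminf[symmetric])
    have "path_law P X C z < top"
      using path_law_le_1[OF fam, of C z] ennreal_one_less_top by (rule le_less_trans)
    moreover have "(\<lambda>n. heat t (z - x n)) \<longlonglongrightarrow> heat t (z - a)"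
      by (rule continuous_on_tendsto_compose[OF heat_continuous]) (auto intro!: tendsto_intros x)
    ultimately show "(\<lambda>n. path_law P X C z * heat t (z - x n)) \<longlonglongrightarrow> path_law P X C z * heat t (z - a)"
      by (rule ennreal_tendsto_cmult)
  qed simp
  then have "(\<integral>\<^sup>+z. path_law P X C z * heat t (z - a) \<partial>lborel) =
      (\<integral>\<^sup>+z. liminf (\<lambda>n. path_law P X C z * heat t (z - x n)) \<partial>lborel)" by simp
  also have "\<dots> \<le> liminf (\<lambda>n. \<integral>\<^sup>+z. path_law P X C z * heat t (z - x n) \<partial>lborel)"
    by (rule nn_integral_liminf) measurable
  finally show ?thesis .
qed

text \<open>
  Testing rational times is enough to detect that a continuous path leaves the closed ball of radius \<open>r\<close>
  about the origin by time \<open>t\<close>.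
\<close>

definition leaves_ball :: "real \<Rightarrow> real \<Rightarrow> (real \<Rightarrow> 'a::real_normed_vector) set"
  where "leaves_ball r t = {w \<in> space path_space. \<exists>q\<in>rat_times. q \<le> t \<and> r < norm (w q)}"

lemma leaves_ball_measurable: "leaves_ball r t \<in> sets (path_space :: (real \<Rightarrow> real ^ 'n) measure)"
proof -
  note [simp] = countable_rat_times
  show ?thesis unfolding leaves_ball_def by measurable
qed

text \<open>
  By continuity of the paths these decreasing events shrink to one contained in \<open>X\<^sub>0 \<noteq> 0\<close>.
\<close>

lemma leaves_ball_vanishes:
  fixes X :: "real \<Rightarrow> 'w \<Rightarrow> real ^ 'n"
  assumes fam: "brownian_family P X" and r: "0 < r"
  shows "(\<lambda>m. path_law P X (leaves_ball r (inverse (real (Suc m)))) 0) \<longlonglongrightarrow> 0"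
proof -
  note bm = brownian_familyD[OF fam, of 0]
  interpret prob_space "P 0" using bm by (rule brownian_motion_prob_space)
  define L where "L m = {\<omega>\<in>space (P 0). rat_path X 0 \<omega> \<in> leaves_ball r (inverse (real (Suc m)))}" for m
  have Lm: "L m \<in> events" for m
    using measurable_sets[OF rat_path_measurable[OF brownian_motion_measurable[OF bm] order_refl]
        leaves_ball_measurable[of r "inverse (real (Suc m))"]]
    by (simp add: L_def vimage_def Int_def conj_commute)
  have "(\<lambda>m. emeasure (P 0) (L m)) \<longlonglongrightarrow> emeasure (P 0) (\<Inter>m. L m)"
  proof (rule Lim_emeasure_decseq)
    show "decseq L"
    proof (intro decseq_SucI subsetI)
      fix m \<omega> assume "\<omega> \<in> L (Suc m)"
      then obtain q where q: "q \<in> rat_times" "q \<le> inverse (real (Suc (Suc m)))"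
          "r < norm (rat_path X 0 \<omega> q)" "\<omega> \<in> space (P 0)" "rat_path X 0 \<omega> \<in> space path_space"
        unfolding L_def leaves_ball_def by blast
      have "inverse (real (Suc (Suc m))) \<le> inverse (real (Suc m))"
        by (intro le_imp_inverse_le) auto
      then have "q \<le> inverse (real (Suc m))" using q(2) by linarith
      then show "\<omega> \<in> L m" unfolding L_def leaves_ball_def using q(1,3-) by blast
    qed
  qed (use Lm in auto)
  moreover have "emeasure (P 0) (\<Inter>m. L m) = 0"
  proof (rule null_setsD1, subst AE_iff_null_sets)
    show "(\<Inter>m. L m) \<in> events" using Lm by auto
    show "AE \<omega> in P 0. \<omega> \<notin> (\<Inter>m. L m)"
      using brownian_motion_start[OF bm] AE_space
    proof eventually_elim
      fix \<omega> assume \<omega>: "X 0 \<omega> = 0" "\<omega> \<in> space (P 0)"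
      have "X 0 \<omega> \<in> ball 0 r" using \<omega> r by auto
      then obtain d where d: "d > 0" "\<And>s. 0 \<le> s \<Longrightarrow> s \<le> 0 + d \<Longrightarrow> X s \<omega> \<in> ball 0 r"
        using stays_longer[OF brownian_motion_continuous[OF bm \<omega>(2)] open_UNIV open_ball order_refl,
            of 0 r] by auto
      obtain m where m: "inverse (real (Suc m)) < d" using reals_Archimedean d by blast
      have "\<omega> \<notin> L m"
      proof
        assume "\<omega> \<in> L m"
        then obtain q where q: "q \<in> rat_times" "q \<le> inverse (real (Suc m))" "r < norm (X q \<omega>)"
          by (auto simp: L_def leaves_ball_def rat_path_def)
        then show False using d(2)[of q] m rat_times_nonneg[of q] by auto
      qed
      then show "\<omega> \<notin> (\<Inter>m. L m)" by auto
    qed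
  qed
  ultimately show ?thesis unfolding L_def path_law_def by simp
qed

lemma codes_hitting_sets: "codes_hitting C U B \<Longrightarrow> C \<in> sets path_space"
  by (simp add: codes_hitting_def)

lemma hits_iff_rat_path:
  assumes f: "continuous_on {0..} (\<lambda>t. X t \<omega>)" and t: "0 \<le> t"
    and C: "codes_hitting C U B"
  shows "rat_path X t \<omega> \<in> C \<longleftrightarrow> hits U B (\<lambda>s. X (t + s) \<omega>)"
proof -
  have "continuous_on {0..} (\<lambda>s. X (t + s) \<omega>)"
    by (rule continuous_on_compose2[OF f]) (use t in \<open>auto intro!: continuous_intros\<close>)
  then show ?thesis using C by (simp add: codes_hitting_def rat_path_def)
qed

text \<open>
  Restarting the path at time \<open>t\<close> changes the hitting event only if the path has left \<open>U - B\<close> by then.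
  The ball inside \<open>U - B\<close> and translation invariance bound the error independently of \<open>x\<close>.
\<close>

lemma hits_restart_error:
  fixes X :: "real \<Rightarrow> 'w \<Rightarrow> real ^ 'n"
  assumes fam: "brownian_family P X"
    and C: "codes_hitting C U B"
    and x: "cball x r \<subseteq> U - B" and t: "t \<in> rat_times"
  shows "path_law P X C x \<le> emeasure (P x) {\<omega>\<in>space (P x). rat_path X t \<omega> \<in> C} + path_law P X (leaves_ball r t) 0"
    and "emeasure (P x) {\<omega>\<in>space (P x). rat_path X t \<omega> \<in> C} \<le> path_law P X C x + path_law P X (leaves_ball r t) 0"
proof -
  note bm = brownian_familyD[OF fam, of x]
  note Xm = brownian_motion_measurable[OF bm] and cont = brownian_motion_continuous[OF bm]
  have t0: "0 \<le> t" using t by (rule rat_times_nonneg)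
  define L where "L = {\<omega>\<in>space (P x). (\<lambda>q\<in>rat_times. X q \<omega> - x) \<in> leaves_ball r t}"
  define H where "H s = {\<omega>\<in>space (P x). rat_path X s \<omega> \<in> C}" for s
  have L: "emeasure (P x) L = path_law P X (leaves_ball r t) 0"
    unfolding L_def by (rule path_law_translate[OF fam leaves_ball_measurable])
  have Lm: "L \<in> sets (P x)"
  proof -
    have "(\<lambda>\<omega>. \<lambda>q\<in>rat_times. X q \<omega> - x) \<in> P x \<rightarrow>\<^sub>M path_space"
      by (rule measurable_restrict) (use Xm rat_times_nonneg in auto)
    from measurable_sets[OF this leaves_ball_measurable] show ?thesis
      by (simp add: L_def vimage_def Int_def conj_commute)
  qed
  have Hm: "H s \<in> sets (P x)" if "0 \<le> s" for s
    using measurable_sets[OF rat_path_measurable[OF Xm that] codes_hitting_sets[OF C]] by (simp add: H_def vimage_def Int_def conj_commute)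
  have eq: "\<omega> \<in> H 0 \<longleftrightarrow> \<omega> \<in> H t" if \<omega>: "\<omega> \<in> space (P x)" "\<omega> \<notin> L" for \<omega>
  proof -
    have cn: "continuous_on {0..} (\<lambda>s. - norm (X s \<omega> - x))"
      using cont[OF \<omega>(1)] by (intro continuous_intros)
    have le: "- r \<le> - norm (X q \<omega> - x)" if "q \<in> rat_times" "q \<le> t" for q
      using \<omega> that by (force simp: L_def leaves_ball_def space_PiM)
    have "X s \<omega> \<in> U - B" if "s \<in> {0..t}" for s
    proof -
      have "- r \<le> - norm (X s \<omega> - x)"
        using lower_bound_rat_times[OF cn le, of t s] le[OF t] that by (cases "s = t") auto
      then show ?thesis using x by (auto simp: dist_norm norm_minus_commute subset_eq)
    qed
    from hits_shift[OF t0 this]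
    have "hits U B (\<lambda>s. X (t + s) \<omega>) \<longleftrightarrow> hits U B (\<lambda>s. X s \<omega>)" by simp
    then show ?thesis unfolding H_def
      using hits_iff_rat_path[where X=X and t=t, OF cont[OF \<omega>(1)] t0 C]
        hits_iff_rat_path[where X=X and t=0, OF cont[OF \<omega>(1)] order_refl C] by simp
  qed
  have Hs: "H s \<subseteq> space (P x)" for s by (auto simp: H_def)
  have "H 0 \<subseteq> H t \<union> L" using eq Hs by blast
  then have "emeasure (P x) (H 0) \<le> emeasure (P x) (H t \<union> L)"
    using Hm[of t] t0 Lm by (intro emeasure_mono) auto
  also have "\<dots> \<le> emeasure (P x) (H t) + emeasure (P x) L"
    using Hm t0 Lm by (intro emeasure_subadditive) auto
  finally show "path_law P X C x \<le> emeasure (P x) {\<omega>\<in>space (P x). rat_path X t \<omega> \<in> C} + path_law P X (leaves_ball r t) 0"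
    unfolding L by (simp add: H_def path_law_def)
  have "H t \<subseteq> H 0 \<union> L" using eq Hs by blast
  then have "emeasure (P x) (H t) \<le> emeasure (P x) (H 0 \<union> L)"
    using Hm[of 0] t0 Lm by (intro emeasure_mono) auto
  also have "\<dots> \<le> emeasure (P x) (H 0) + emeasure (P x) L"
    using Hm t0 Lm by (intro emeasure_subadditive) auto
  finally show "emeasure (P x) {\<omega>\<in>space (P x). rat_path X t \<omega> \<in> C} \<le> path_law P X C x + path_law P X (leaves_ball r t) 0"
    unfolding L by (simp add: H_def path_law_def)
qed

text \<open>
  Write \<open>Q\<^sub>t h\<close> for the expectation of \<open>h(X\<^sub>t)\<close> and \<open>e\<close> for the error of restarting at time \<open>t\<close>, uniform near
  \<open>a\<close>. If points \<open>x\<^sub>n\<close> with \<open>h(x\<^sub>n) \<le> c\<close> converged to \<open>a\<close>, then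
  \<open>h(a) \<le> Q\<^sub>t h(a) + e \<le> liminf Q\<^sub>t h(x\<^sub>n) + e \<le> c + 2e\<close>, and \<open>e\<close> tends to \<open>0\<close> with \<open>t\<close>.
\<close>

lemma hits_law_lsc:
  fixes X :: "real \<Rightarrow> 'w \<Rightarrow> real ^ 'n"
  assumes fam: "brownian_family P X" and V: "open (U - B)"
    and C: "codes_hitting C U B"
  shows "open {x \<in> U - B. c < path_law P X C x}"
  unfolding open_contains_ball
proof (rule ballI, rule ccontr)
  let ?h = "path_law P X C"
  fix a assume "a \<in> {x \<in> U - B. c < ?h x}"
  then have a: "a \<in> U - B" "c < ?h a" by auto
  assume no: "\<not> (\<exists>e>0. ball a e \<subseteq> {x \<in> U - B. c < ?h x})"
  obtain R where R: "R > 0" "cball a R \<subseteq> U - B"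
    using V a(1) unfolding open_contains_cball by blast
  define r where "r = R / 2"
  have r: "r > 0" "\<And>x. dist a x < r \<Longrightarrow> cball x r \<subseteq> U - B"
  proof -
    show "r > 0" using R by (simp add: r_def)
    fix x assume x: "dist a x < r"
    have "cball x r \<subseteq> cball a R"
    proof
      fix y assume "y \<in> cball x r"
      then show "y \<in> cball a R" using x dist_triangle[of a y x] by (auto simp: r_def)
    qed
    then show "cball x r \<subseteq> U - B" using R by auto
  qed
  have "\<exists>x. dist a x < min r (inverse (real (Suc n))) \<and> ?h x \<le> c" for n
  proof -
    have "min r (inverse (real (Suc n))) > 0" using r by simp
    then have "\<not> ball a (min r (inverse (real (Suc n)))) \<subseteq> {x \<in> U - B. c < ?h x}" using no by blast
    then obtain x where x: "dist a x < min r (inverse (real (Suc n)))" "x \<notin> {x \<in> U - B. c < ?h x}"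
      unfolding subset_iff mem_ball by blast
    have "x \<in> cball x r" "dist a x < r" using r(1) x(1) by auto
    then have "x \<in> U - B" using r(2) by blast
    then show ?thesis using x by auto
  qed
  then obtain x where x: "\<And>n. dist a (x n) < min r (inverse (real (Suc n)))" "\<And>n. ?h (x n) \<le> c"
    by metis
  have lim: "x \<longlonglongrightarrow> a"
  proof (rule metric_LIMSEQ_I)
    fix e :: real assume "e > 0"
    then obtain N where N: "inverse (real (Suc N)) < e" using reals_Archimedean by blast
    have "dist (x n) a < e" if "n \<ge> N" for n
    proof -
      have "inverse (real (Suc n)) \<le> inverse (real (Suc N))" using that by (intro le_imp_inverse_le) auto
      then show ?thesis using x(1)[of n] N unfolding min_less_iff_conj dist_commute[of _ a] by linarith
    qed
    then show "\<exists>N. \<forall>n\<ge>N. dist (x n) a < e" by blast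
  qed
  define e where "e m = path_law P X (leaves_ball r (inverse (real (Suc m)))) 0" for m
  have "?h a \<le> c + e m + e m" for m
  proof -
    define t where "t = inverse (real (Suc m))"
    have t: "t \<in> rat_times" "0 < t" unfolding t_def rat_times_def
      by (auto intro!: Rats_inverse)
    define Q where "Q x = emeasure (P x) {\<omega>\<in>space (P x). rat_path X t \<omega> \<in> C}" for x
    have "Q a \<le> liminf (\<lambda>n. Q (x n))"
      unfolding Q_def one_step_density[OF fam codes_hitting_sets[OF C] t(2)] by (rule one_step_lsc[OF fam codes_hitting_sets[OF C] lim])
    also have "\<dots> \<le> c + e m"
    proof (rule Liminf_le)
      have "Q (x n) \<le> c + e m" for n
      proof -
        have "Q (x n) \<le> ?h (x n) + e m"
          using hits_restart_error(2)[OF fam C r(2) t(1), of "x n"] x(1)[of n] unfolding Q_def e_def t_def by simp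
        also have "\<dots> \<le> c + e m" using x(2) by (intro add_right_mono)
        finally show ?thesis .
      qed
      then show "\<forall>\<^sub>F n in sequentially. Q (x n) \<le> c + e m" by simp
    qed simp
    finally have "Q a + e m \<le> c + e m + e m" by (intro add_right_mono)
    moreover have "?h a \<le> Q a + e m"
      using hits_restart_error(1)[OF fam C r(2) t(1), of a] r(1) unfolding Q_def e_def t_def by simp
    ultimately show ?thesis by (rule order_trans[rotated])
  qed
  moreover have "(\<lambda>m. c + e m + e m) \<longlonglongrightarrow> c + 0 + 0"
    unfolding e_def by (intro tendsto_add tendsto_const leaves_ball_vanishes[OF fam r(1)])
  ultimately have "?h a \<le> c + 0 + 0" by (intro LIMSEQ_le_const) auto
  then show False using a(2) by simp
qed

section \<open>Late visits\<close>

text \<open>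
  The rational description of staying in \<open>V\<close> up to time \<open>t\<close> involves positions up to time \<open>t\<close> only.
\<close>

lemma stays_past_measurable:
  fixes X :: "real \<Rightarrow> 'w \<Rightarrow> 'a::metric_space"
  assumes cont: "\<And>\<omega>. \<omega> \<in> space M \<Longrightarrow> continuous_on {0..} (\<lambda>t. X t \<omega>)" and V: "open V" and t: "0 \<le> t"
  shows "{\<omega>\<in>space M. \<forall>s\<in>{0..t}. X s \<omega> \<in> V} \<in> sets (past M X t)"
proof -
  obtain g where g: "continuous_on UNIV g" "\<And>x. x \<in> V \<longleftrightarrow> 0 < (g x :: real)"
    using open_eq_positivity_set[OF V] by metis
  have [measurable]: "g \<in> borel_measurable borel" using g(1) by (rule borel_measurable_continuous_onI)
  have [measurable]: "V \<in> sets borel" using V by simp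
  have [measurable]: "X t \<in> past M X t \<rightarrow>\<^sub>M borel" by (rule past_component[OF t order_refl])
  have Q: "countable (rat_times \<inter> {..t})" using countable_rat_times by auto
  have "{\<omega>\<in>space (past M X t). \<forall>q\<in>rat_times \<inter> {..t}. inverse (real (Suc m)) \<le> g (X q \<omega>)} \<in> sets (past M X t)" for m :: nat
  proof (rule sets.sets_Collect_countable_All'[OF _ Q])
    fix q assume "q \<in> rat_times \<inter> {..t}"
    then have [measurable]: "X q \<in> past M X t \<rightarrow>\<^sub>M borel"
      using rat_times_nonneg by (intro past_component) auto
    show "{\<omega>\<in>space (past M X t). inverse (real (Suc m)) \<le> g (X q \<omega>)} \<in> sets (past M X t)" by measurable
  qed
  then have [measurable]: "{\<omega>\<in>space (past M X t). \<exists>m::nat. \<forall>q\<in>rat_times \<inter> {..t}. inverse (real (Suc m)) \<le> g (X q \<omega>)} \<in> sets (past M X t)"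
    by (rule sets.sets_Collect_countable_Ex)
  have eq: "(\<forall>q\<in>rat_times \<inter> {..t}. R q) \<longleftrightarrow> (\<forall>q\<in>rat_times. q \<le> t \<longrightarrow> R q)" for R by auto
  have "{\<omega>\<in>space M. \<forall>s\<in>{0..t}. X s \<omega> \<in> V} = {\<omega>\<in>space (past M X t). X t \<omega> \<in> V} \<inter>
      {\<omega>\<in>space (past M X t). \<exists>m::nat. \<forall>q\<in>rat_times \<inter> {..t}. inverse (real (Suc m)) \<le> g (X q \<omega>)}"
    unfolding eq using stays_iff_rat_times[OF cont g t] by auto
  also have "\<dots> \<in> sets (past M X t)" by measurable
  finally show ?thesis .
qed

text \<open>
  If, whenever \<open>E t\<close> occurs, \<open>D\<close> still has conditional probability at least \<open>c\<close> given the information at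
  time \<open>t\<close>, then the same holds given that some \<open>E t\<close> occurs: condition on the first such time. For
  finitely many times this is an induction that adds the largest time \<open>b\<close>, because the union of the
  earlier events is known at time \<open>b\<close> and can be removed from \<open>E b\<close>. Countably many times follow by
  monotone convergence.
\<close>

lemma uniform_conditional_bound_union:
  fixes F :: "'i::linorder \<Rightarrow> 'w set set" and c :: ennreal
  assumes mono: "\<And>s t. s \<in> I \<Longrightarrow> t \<in> I \<Longrightarrow> s \<le> t \<Longrightarrow> F s \<subseteq> F t"
    and alg: "\<And>t. t \<in> I \<Longrightarrow> sigma_algebra (space M) (F t)" and sub: "\<And>t. t \<in> I \<Longrightarrow> F t \<subseteq> sets M"
    and D: "D \<in> sets M" and E: "\<And>t. t \<in> I \<Longrightarrow> E t \<in> F t" and I: "countable I"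
    and bound: "\<And>t W. t \<in> I \<Longrightarrow> W \<in> F t \<Longrightarrow> W \<subseteq> E t \<Longrightarrow> c * emeasure M W \<le> emeasure M (D \<inter> W)"
  shows "c * emeasure M (\<Union>t\<in>I. E t) \<le> emeasure M (D \<inter> (\<Union>t\<in>I. E t))"
proof -
  have EM: "E t \<in> sets M" if "t \<in> I" for t using E sub that by blast
  have fin: "c * emeasure M (\<Union>t\<in>S. E t) \<le> emeasure M (D \<inter> (\<Union>t\<in>S. E t))"
    if "finite S" "S \<subseteq> I" for S
    using that
  proof (induction S rule: finite_linorder_max_induct)
    case empty
    then show ?case by simp
  next
    case (insert b S)
    define H where "H = (\<Union>t\<in>S. E t)"
    define W where "W = E b - H"
    interpret b: sigma_algebra "space M" "F b" using alg insert by auto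
    have "E t \<in> F b" if "t \<in> S" for t
      using that insert E[of t] mono[of t b] by (auto simp: less_imp_le)
    then have H: "H \<in> F b" unfolding H_def using insert(1) by (intro b.finite_UN) auto
    then have W: "W \<in> F b" unfolding W_def using E[of b] insert by auto
    have HM: "H \<in> sets M" and WM: "W \<in> sets M" using H W sub[of b] insert by auto
    have "c * emeasure M (\<Union>t\<in>insert b S. E t) = c * (emeasure M H + emeasure M W)"
      using HM WM by (subst plus_emeasure) (auto simp: W_def H_def intro!: arg_cong[where f="\<lambda>A. c * emeasure M A"])
    also have "\<dots> = c * emeasure M H + c * emeasure M W" by (rule distrib_left)
    also have "\<dots> \<le> emeasure M (D \<inter> H) + emeasure M (D \<inter> W)"
      using insert.IH insert.prems bound[of b W] W by (intro add_mono) (auto simp: H_def W_def)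
    also have "\<dots> = emeasure M (D \<inter> (\<Union>t\<in>insert b S. E t))"
      using HM WM D by (subst plus_emeasure) (auto simp: W_def H_def intro!: arg_cong[where f="emeasure M"])
    finally show ?case .
  qed
  show ?thesis
  proof (cases "I = {}")
    case False
    define S where "S n = from_nat_into I ` {..n}" for n
    have S: "finite (S n)" "S n \<subseteq> I" for n
      using from_nat_into[OF False] by (auto simp: S_def)
    have US: "(\<Union>n. S n) = I"
      unfolding S_def image_UN[symmetric] UN_atMost_UNIV by (rule range_from_nat_into[OF False I])
    define G where "G n = (\<Union>t\<in>S n. E t)" for n
    have "(\<Union>t\<in>I. E t) = (\<Union>n. G n)" unfolding G_def US[symmetric] by auto
    also have "emeasure M \<dots> = (SUP n. emeasure M (G n))"
    proof (rule SUP_emeasure_incseq[symmetric])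
      show "range G \<subseteq> sets M" using S EM unfolding G_def by (auto intro!: sets.finite_UN)
      show "incseq G" unfolding G_def S_def incseq_def by (intro allI impI UN_mono image_mono) auto
    qed
    finally have "c * emeasure M (\<Union>t\<in>I. E t) = (SUP n. c * emeasure M (G n))"
      by (simp add: SUP_mult_left_ennreal)
    also have "\<dots> \<le> emeasure M (D \<inter> (\<Union>t\<in>I. E t))"
    proof (rule SUP_least)
      fix n
      have "c * emeasure M (G n) \<le> emeasure M (D \<inter> G n)" unfolding G_def by (rule fin[OF S])
      also have "\<dots> \<le> emeasure M (D \<inter> (\<Union>t\<in>I. E t))"
        using D EM I S(2) unfolding G_def by (intro emeasure_mono sets.Int sets.countable_UN'') auto
      finally show "c * emeasure M (G n) \<le> emeasure M (D \<inter> (\<Union>t\<in>I. E t))" .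
    qed
    finally show ?thesis .
  qed simp
qed

text \<open>
  The path is at stage \<open>n\<close> of its way out of \<open>U\<close>: either the time is at least \<open>n\<close>, or the path has come
  close to the complement, as measured by \<open>g\<close>. Both alternatives are needed since the exit time
  from \<open>U\<close> may be infinite or finite.
\<close>

definition late :: "('a \<Rightarrow> real) \<Rightarrow> nat \<Rightarrow> (real \<Rightarrow> 'a) \<Rightarrow> real \<Rightarrow> bool"
  where "late g n f t \<longleftrightarrow> real n \<le> t \<or> (\<exists>s\<in>rat_times. s \<le> t \<and> g (f s) < inverse (Suc n))"

text \<open>
  Such a path reaches stage \<open>n\<close> before it leaves \<open>U\<close>: if it never leaves, time itself
  grows; otherwise \<open>g\<close> tends to \<open>0\<close> along the path as the first exit time approaches. After that stage it
  still meets \<open>A\<close> inside \<open>U\<close>, at a point outside \<open>B\<close> and therefore in \<open>G\<close>; as \<open>G\<close> is open, it is also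
  in \<open>G\<close> at some slightly later rational time.
\<close>

lemma late_visit:
  fixes f :: "real \<Rightarrow> 'a::metric_space"
  assumes f: "continuous_on {0..} f" and U: "open U"
    and g: "continuous_on UNIV g" "\<And>x. x \<in> U \<longleftrightarrow> 0 < (g x :: real)"
    and start: "f 0 \<in> U" and nohit: "\<not> hits U B f"
    and G: "open G" "A - B \<subseteq> G"
    and restart: "\<And>t. t \<in> rat_times \<Longrightarrow> (\<And>s. s \<in> {0..t} \<Longrightarrow> f s \<in> U) \<Longrightarrow> hits U A (\<lambda>s. f (t + s))"
  shows "\<exists>t\<in>rat_times. f t \<in> G \<and> late g n f t \<and> (\<forall>s\<in>{0..t}. f s \<in> U - B)"
proof -
  have gf: "continuous_on {0..} (\<lambda>s. g (f s))"
    by (rule continuous_on_compose2[OF g(1) f]) auto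
  have avoid: "f t \<notin> B" if "0 \<le> t" "\<And>s. s \<in> {0..t} \<Longrightarrow> f s \<in> U" for t
    using nohit that unfolding hits_def by blast
  obtain t0 where t0: "t0 \<in> rat_times" "\<And>s. s \<in> {0..t0} \<Longrightarrow> f s \<in> U" "late g n f t0"
  proof (cases "\<forall>s\<ge>0. f s \<in> U")
    case True
    then show ?thesis by (intro that[of "real n"]) (auto simp: rat_times_def late_def)
  next
    case False
    then obtain u where u: "u \<ge> 0" "f u \<notin> U" by auto
    \<comment> \<open>The infimum of \<open>Z\<close> is the first exit time from \<open>U\<close>; it belongs to \<open>Z\<close>, which is closed.\<close>
    define Z where "Z = {s\<in>{0..u}. g (f s) \<le> 0}"
    have "closed Z" unfolding Z_def
      by (intro continuous_on_closed_Collect_le) (auto intro: continuous_on_subset[OF gf])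
    moreover have "u \<in> Z" "bdd_below Z" using u g(2) by (auto simp: Z_def not_less bdd_below_def)
    ultimately have sZ: "Inf Z \<in> Z" and low: "\<And>s. s \<in> Z \<Longrightarrow> Inf Z \<le> s"
      by (auto intro!: closed_contains_Inf cInf_lower)
    define \<sigma> where "\<sigma> = Inf Z"
    have \<sigma>: "0 \<le> \<sigma>" "\<sigma> \<le> u" "g (f \<sigma>) \<le> 0" using sZ by (auto simp: \<sigma>_def Z_def)
    have before: "f s \<in> U" if "0 \<le> s" "s < \<sigma>" for s
    proof (rule ccontr)
      assume "f s \<notin> U"
      then have "s \<in> Z" using that \<sigma> g(2)[of "f s"] by (auto simp: Z_def)
      then show False using low[of s] that(2) by (simp add: \<sigma>_def)
    qed
    have "\<sigma> \<noteq> 0" using start \<sigma>(3) g(2) by auto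
    then have "0 < \<sigma>" using \<sigma> by auto
    have "\<exists>q\<in>rat_times. q < \<sigma> \<and> g (f q) < inverse (real (Suc n))"
    proof (rule ccontr)
      assume no: "\<not> ?thesis"
      define e where "e = inverse (real (Suc n))"
      have e: "e > 0" by (simp add: e_def)
      then obtain d where d: "d > 0" "\<And>s. s \<in> {0..} \<Longrightarrow> dist s \<sigma> < d \<Longrightarrow> dist (g (f s)) (g (f \<sigma>)) < e"
        using gf \<sigma>(1) unfolding continuous_on_iff by (metis atLeast_iff)
      obtain q where q: "q \<in> rat_times" "max 0 (\<sigma> - d) < q" "q < \<sigma>"
        using rat_times_between[of "max 0 (\<sigma> - d)" \<sigma>] d(1) \<open>0 < \<sigma>\<close> by auto
      have "g (f q) < e" using d(2)[of q] q \<sigma>(3) by (auto simp: dist_real_def)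
      then show False using no q by (auto simp: e_def)
    qed
    then obtain q where "q \<in> rat_times" "q < \<sigma>" "g (f q) < inverse (real (Suc n))" by auto
    then show ?thesis
      by (intro that[of q]) (use before in \<open>auto simp: late_def\<close>)
  qed
  have t00: "0 \<le> t0" using t0(1) by (rule rat_times_nonneg)
  have "hits U A (\<lambda>s. f (t0 + s))" by (rule restart[OF t0(1,2)])
  then obtain v where v: "v \<ge> 0" "f (t0 + v) \<in> A" "\<And>s. s \<in> {0..v} \<Longrightarrow> f (t0 + s) \<in> U"
    by (auto simp: hits_def)
  define T where "T = t0 + v"
  have T: "0 \<le> T" "t0 \<le> T" "f T \<in> A" using v t00 by (auto simp: T_def)
  have TU: "f s \<in> U" if "s \<in> {0..T}" for s
    using t0(2)[of s] v(3)[of "s - t0"] that by (cases "s \<le> t0") (auto simp: T_def)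
  have "f T \<in> G" using G(2) T avoid[of T] TU by auto
  with stays_longer[OF f U G(1) T(1) _ TU] obtain d where d: "d > 0"
    "\<And>s. 0 \<le> s \<Longrightarrow> s \<le> T + d \<Longrightarrow> f s \<in> U" "\<And>s. T \<le> s \<Longrightarrow> s \<le> T + d \<Longrightarrow> f s \<in> G" by metis
  obtain t where t: "t \<in> rat_times" "T < t" "t < T + d"
    using rat_times_between[of T "T + d"] d(1) T(1) by auto
  have "late g n f t" using t0(3) T(2) t(2) unfolding late_def by (auto intro: order_trans less_imp_le)
  moreover have "f s \<in> U - B" if "s \<in> {0..t}" for s
    using avoid[of s] d(2) that t(3) by auto
  ultimately show ?thesis using t d(3)[of t] by (intro bexI[of _ t]) auto
qed

section \<open>Transfer of unavoidability\<close>

lemma hits_event_measurable: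
  fixes X :: "real \<Rightarrow> 'w \<Rightarrow> real ^ 'n"
  assumes bm: "brownian_motion M X x" and C: "codes_hitting C U B" and t: "0 \<le> t"
  shows "{\<omega>\<in>space M. hits U B (\<lambda>s. X (t + s) \<omega>)} \<in> sets M"
    and "{\<omega>\<in>space M. hits U B (\<lambda>s. X (t + s) \<omega>)} = {\<omega>\<in>space M. rat_path X t \<omega> \<in> C}"
proof -
  show *: "{\<omega>\<in>space M. hits U B (\<lambda>s. X (t + s) \<omega>)} = {\<omega>\<in>space M. rat_path X t \<omega> \<in> C}"
    using hits_iff_rat_path[where X=X, OF brownian_motion_continuous[OF bm] t C] by auto
  show "{\<omega>\<in>space M. hits U B (\<lambda>s. X (t + s) \<omega>)} \<in> sets M"
    using measurable_sets[OF rat_path_measurable[OF brownian_motion_measurable[OF bm] t] codes_hitting_sets[OF C]]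
    unfolding * by (simp add: vimage_def Int_def conj_commute)
qed

lemma hit_prob_eq_path_law:
  fixes X :: "real \<Rightarrow> 'w \<Rightarrow> real ^ 'n"
  assumes fam: "brownian_family P X" and U: "open U"
    and C: "codes_hitting C U B"
  shows "ennreal (hit_prob P X U B x) = path_law P X C x"
proof -
  note bm = brownian_familyD[OF fam, of x]
  interpret prob_space "P x" using bm by (rule brownian_motion_prob_space)
  have "{\<omega>\<in>space (P x). entry_time X B \<omega> < entry_time X (- U) \<omega>} = {\<omega>\<in>space (P x). rat_path X 0 \<omega> \<in> C}"
    using entry_time_less_iff_hits[where X=X, OF brownian_motion_continuous[OF bm] U]
      hits_iff_rat_path[where X=X and t=0, OF brownian_motion_continuous[OF bm] order_refl C] by auto
  then show ?thesis unfolding hit_prob_def path_law_def by (simp add: emeasure_eq_measure)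
qed

text \<open>
  The Markov property at time \<open>t\<close>, with the hitting probability of \<open>A\<close> equal to one at every point of \<open>U\<close>;
  at points of \<open>A\<close> this holds because \<open>A\<close> is hit at time \<open>0\<close>. Since the statement concerns only
  rational \<open>t\<close>, one null set serves for all of them.
\<close>

lemma unavoidable_restart:
  fixes X :: "real \<Rightarrow> 'w \<Rightarrow> real ^ 'n"
  assumes fam: "brownian_family P X" and U: "open U" and A: "unavoidable P X U A"
  shows "AE \<omega> in P y. \<forall>t\<in>rat_times. (\<forall>s\<in>{0..t}. X s \<omega> \<in> U) \<longrightarrow> hits U A (\<lambda>s. X (t + s) \<omega>)"
proof -
  note bm = brownian_familyD[OF fam]
  interpret prob_space "P y" using bm by (rule brownian_motion_prob_space)
  obtain C where C: "codes_hitting C U A"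
    using codes_hitting_exists[OF U, of A] A unfolding unavoidable_def by metis
  have one: "path_law P X C x = 1" if x: "x \<in> U" for x
  proof (cases "x \<in> A")
    case False
    then have "hit_prob P X U A x = 1" using A x by (auto simp: unavoidable_def)
    then show ?thesis using hit_prob_eq_path_law[OF fam U C, of x] by simp
  next
    case True
    interpret Px: prob_space "P x" using bm by (rule brownian_motion_prob_space)
    have "emeasure (P x) {\<omega>\<in>space (P x). hits U A (\<lambda>s. X (0 + s) \<omega>)} = 1"
    proof (rule Px.emeasure_eq_1_AE[OF hits_event_measurable(1)[OF bm C order_refl]])
      show "AE \<omega> in P x. \<omega> \<in> {\<omega>\<in>space (P x). hits U A (\<lambda>s. X (0 + s) \<omega>)}"
        using brownian_motion_start[OF bm, of x] AE_space
      proof eventually_elim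
        case (elim \<omega>)
        then show ?case using True x by (auto simp: hits_def intro!: exI[of _ 0])
      qed
    qed
    then show ?thesis unfolding path_law_def hits_event_measurable(2)[OF bm C order_refl] .
  qed
  have "AE \<omega> in P y. (\<forall>s\<in>{0..t}. X s \<omega> \<in> U) \<longrightarrow> hits U A (\<lambda>s. X (t + s) \<omega>)" if t: "t \<in> rat_times" for t
  proof -
    have t0: "0 \<le> t" using t by (rule rat_times_nonneg)
    define S where "S = {\<omega>\<in>space (P y). \<forall>s\<in>{0..t}. X s \<omega> \<in> U}"
    define H where "H = {\<omega>\<in>space (P y). hits U A (\<lambda>s. X (t + s) \<omega>)}"
    have S: "S \<in> sets (past (P y) X t)"
      unfolding S_def by (rule stays_past_measurable[OF brownian_motion_continuous[OF bm] U t0])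
    have SM: "S \<in> events"
      by (rule subsetD[OF sets_past_subset S]) (rule brownian_motion_measurable[OF bm])
    have HM: "H \<in> events" unfolding H_def by (rule hits_event_measurable(1)[OF bm C t0])
    have "emeasure (P y) (S \<inter> H) = (\<integral>\<^sup>+\<omega>. indicator S \<omega> * path_law P X C (X t \<omega>) \<partial>P y)"
      unfolding H_def hits_event_measurable(2)[OF bm C t0] by (rule markov_path[OF fam bm t0 S codes_hitting_sets[OF C]])
    also have "\<dots> = (\<integral>\<^sup>+\<omega>. indicator S \<omega> \<partial>P y)"
      using one t0 by (intro nn_integral_cong) (auto simp: S_def indicator_def)
    also have "\<dots> = emeasure (P y) S" using SM by simp
    finally have "emeasure (P y) (S - (S \<inter> H)) = 0"
      using SM HM by (subst emeasure_Diff) auto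
    then have "S - (S \<inter> H) \<in> null_sets (P y)" using SM HM by auto
    from AE_not_in[OF this] AE_space show ?thesis
      by eventually_elim (auto simp: S_def H_def)
  qed
  then show ?thesis by (simp add: AE_ball_countable countable_rat_times)
qed

theorem proposition1p2:
  fixes P :: "real ^ 'n \<Rightarrow> 'w measure"
    and X :: "real \<Rightarrow> 'w \<Rightarrow> real ^ 'n"
    and U A B :: "(real ^ 'n) set"
    and \<kappa> :: real
  assumes "CARD('n) \<ge> 2"
    and "brownian_family P X"
    and "U \<noteq> {}" and "open U" and "connected U"
    and "CARD('n) = 2 \<Longrightarrow> \<not> polar (- U)"
    and "closedin (top_of_set U) A" and "closedin (top_of_set U) B"
    and "\<kappa> > 0"
    and "unavoidable P X U A"
    and "\<And>x. x \<in> A \<Longrightarrow> hit_prob P X U B x \<ge> \<kappa>"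
  shows "unavoidable P X U B"
  unfolding unavoidable_def
proof (intro conjI ballI)
  show "closedin (top_of_set U) B" by fact
  fix y assume y: "y \<in> U - B"
  note fam = assms(2) and U = assms(4)
  note bm = brownian_familyD[OF fam]
  note cont = brownian_motion_continuous[OF bm] and Xm = brownian_motion_measurable[OF bm]
  interpret prob_space "P y" using bm by (rule brownian_motion_prob_space)
  obtain C where C: "codes_hitting C U B"
    using codes_hitting_exists[OF U assms(8)] by metis
  obtain g where g: "continuous_on UNIV g" "\<And>x. x \<in> U \<longleftrightarrow> 0 < (g x :: real)"
    using open_eq_positivity_set[OF U] by metis
  have V: "open (U - B)"
  proof -
    obtain F where "closed F" "B = U \<inter> F" using assms(8) by (auto simp: closedin_closed)
    moreover have "U - U \<inter> F = U \<inter> - F" by auto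
    ultimately show ?thesis using U by auto
  qed
  \<comment> \<open>Half of \<open>\<kappa>\<close> leaves room for the strict inequality that makes \<open>G\<close> open.\<close>
  define c where "c = ennreal (\<kappa> / 2)"
  define G where "G = {x \<in> U - B. c < path_law P X C x}"
  have G: "open G" unfolding G_def by (rule hits_law_lsc[OF fam V C])
  have AG: "A - B \<subseteq> G"
  proof
    fix x assume x: "x \<in> A - B"
    have "ennreal (\<kappa> / 2) < ennreal \<kappa>" using assms(9) by (simp add: ennreal_lessI)
    also have "\<dots> \<le> ennreal (hit_prob P X U B x)" using assms(11) x by (intro ennreal_leI) auto
    also have "\<dots> = path_law P X C x" by (rule hit_prob_eq_path_law[OF fam U C])
    finally show "x \<in> G" using x closedin_imp_subset[OF assms(7)] by (auto simp: G_def c_def)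
  qed
  define D where "D = {\<omega>\<in>space (P y). hits U B (\<lambda>t. X t \<omega>)}"
  have DM: "D \<in> events" using hits_event_measurable(1)[OF bm C order_refl, of y] by (simp add: D_def)
  define E where "E n t = {\<omega>\<in>space (P y). X t \<omega> \<in> G \<and> late g n (\<lambda>s. X s \<omega>) t \<and> (\<forall>s\<in>{0..t}. X s \<omega> \<in> U - B)}" for n t
  have EF: "E n t \<in> sets (past (P y) X t)" if t: "t \<in> rat_times" for n t
  proof -
    have t0: "0 \<le> t" using t by (rule rat_times_nonneg)
    let ?N = "past (P y) X t"
    have [measurable]: "X t \<in> ?N \<rightarrow>\<^sub>M borel" by (rule past_component[OF t0 order_refl])
    have [measurable]: "G \<in> sets borel" using G by simp
    have [measurable]: "g \<in> borel_measurable borel" using g(1) by (rule borel_measurable_continuous_onI)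
    have "{\<omega>\<in>space ?N. \<exists>s\<in>rat_times \<inter> {..t}. g (X s \<omega>) < inverse (Suc n)} \<in> sets ?N"
    proof (rule sets.sets_Collect_countable_Ex')
      fix s assume "s \<in> rat_times \<inter> {..t}"
      then have [measurable]: "X s \<in> ?N \<rightarrow>\<^sub>M borel" using rat_times_nonneg by (intro past_component) auto
      show "{\<omega>\<in>space ?N. g (X s \<omega>) < inverse (Suc n)} \<in> sets ?N" by measurable
    qed (use countable_rat_times in auto)
    moreover have "{\<omega>\<in>space (P y). \<forall>s\<in>{0..t}. X s \<omega> \<in> U - B} \<in> sets ?N"
      by (rule stays_past_measurable[OF cont V t0])
    moreover have "{\<omega>\<in>space ?N. X t \<omega> \<in> G} \<in> sets ?N" "{\<omega>\<in>space ?N. real n \<le> t} \<in> sets ?N" by measurable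
    ultimately have "{\<omega>\<in>space ?N. X t \<omega> \<in> G} \<inter> ({\<omega>\<in>space ?N. real n \<le> t} \<union>
      {\<omega>\<in>space ?N. \<exists>s\<in>rat_times \<inter> {..t}. g (X s \<omega>) < inverse (Suc n)}) \<inter>
      {\<omega>\<in>space (P y). \<forall>s\<in>{0..t}. X s \<omega> \<in> U - B} \<in> sets ?N" by (intro sets.Int sets.Un)
    also have "{\<omega>\<in>space ?N. X t \<omega> \<in> G} \<inter> ({\<omega>\<in>space ?N. real n \<le> t} \<union>
      {\<omega>\<in>space ?N. \<exists>s\<in>rat_times \<inter> {..t}. g (X s \<omega>) < inverse (Suc n)}) \<inter>
      {\<omega>\<in>space (P y). \<forall>s\<in>{0..t}. X s \<omega> \<in> U - B} = E n t"
      unfolding E_def late_def by auto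
    finally show ?thesis .
  qed
  have subM: "sets (past (P y) X t) \<subseteq> events" for t by (rule sets_past_subset[OF Xm])
  define H where "H n = (\<Union>t\<in>rat_times. E n t)" for n
  have HM: "H n \<in> events" for n
    unfolding H_def using EF subM by (intro sets.countable_UN'' countable_rat_times) blast
  \<comment> \<open>On \<open>W\<close> the path has not left \<open>U - B\<close> and sits in \<open>G\<close>, so restarting it at time \<open>t\<close> gives the bound.\<close>
  have key: "c * emeasure (P y) (H n) \<le> emeasure (P y) (D \<inter> H n)" for n
    unfolding H_def
  proof (rule uniform_conditional_bound_union[where F = "\<lambda>t. sets (past (P y) X t)"])
    show "sigma_algebra (space (P y)) (sets (past (P y) X t))" for t
      using sets.sigma_algebra_axioms[of "past (P y) X t"] by simp
    show "sets (past (P y) X s) \<subseteq> sets (past (P y) X t)" if "s \<le> t" for s t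
      using that by (rule past_mono)
    fix t W assume t: "t \<in> rat_times" and W: "W \<in> sets (past (P y) X t)" "W \<subseteq> E n t"
    have t0: "0 \<le> t" using t by (rule rat_times_nonneg)
    have WM: "W \<in> events" using W subM by blast
    have "c * emeasure (P y) W = (\<integral>\<^sup>+\<omega>. c * indicator W \<omega> \<partial>P y)"
      using WM by (simp add: nn_integral_cmult_indicator)
    also have "\<dots> \<le> (\<integral>\<^sup>+\<omega>. indicator W \<omega> * path_law P X C (X t \<omega>) \<partial>P y)"
      using W(2) by (intro nn_integral_mono) (auto simp: E_def G_def indicator_def less_imp_le)
    also have "\<dots> = emeasure (P y) (W \<inter> {\<omega>\<in>space (P y). rat_path X t \<omega> \<in> C})"
      by (rule markov_path[OF fam bm t0 W(1) codes_hitting_sets[OF C], symmetric])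
    also have "W \<inter> {\<omega>\<in>space (P y). rat_path X t \<omega> \<in> C} = D \<inter> W"
    proof -
      have "hits U B (\<lambda>s. X (t + s) \<omega>) \<longleftrightarrow> hits U B (\<lambda>s. X s \<omega>)" if "\<omega> \<in> W" for \<omega>
        using W(2) that by (intro hits_shift[OF t0]) (auto simp: E_def)
      then show ?thesis
        using sets.sets_into_space[OF WM]
        unfolding hits_event_measurable(2)[OF bm C t0, symmetric] D_def by auto
    qed
    finally show "c * emeasure (P y) W \<le> emeasure (P y) (D \<inter> W)" .
  qed (use subM DM EF countable_rat_times in auto)
  have ae: "AE \<omega> in P y. \<omega> \<notin> D \<longrightarrow> \<omega> \<in> H n" for n
    using unavoidable_restart[OF fam U assms(10), of y] brownian_motion_start[OF bm, of y] AE_space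
  proof eventually_elim
    case (elim \<omega>)
    show ?case
    proof
      assume "\<omega> \<notin> D"
      then have "\<not> hits U B (\<lambda>t. X t \<omega>)" using elim by (simp add: D_def)
      from late_visit[OF cont[OF elim(3)] U g _ this G AG, of n] elim y
      show "\<omega> \<in> H n" by (auto simp: H_def E_def)
    qed
  qed
  have bound: "c * emeasure (P y) (space (P y) - D) \<le> emeasure (P y) (D \<inter> H n)" for n
  proof -
    have "emeasure (P y) (space (P y) - D) \<le> emeasure (P y) (H n)"
      using ae[of n] HM by (intro emeasure_mono_AE) auto
    then have "c * emeasure (P y) (space (P y) - D) \<le> c * emeasure (P y) (H n)"
      by (rule mult_left_mono) simp
    also note key
    finally show ?thesis .
  qed
  \<comment> \<open>A hit happens at a definite time, so it cannot come after stage \<open>n\<close> for every \<open>n\<close>.\<close>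
  have "(\<lambda>n. emeasure (P y) (D \<inter> H n)) \<longlonglongrightarrow> emeasure (P y) (\<Inter>n. D \<inter> H n)"
  proof (rule Lim_emeasure_decseq)
    have "E (Suc n) t \<subseteq> E n t" for n t
    proof -
      have "inverse (real (Suc (Suc n))) \<le> inverse (real (Suc n))" by (intro le_imp_inverse_le) auto
      then have "late g (Suc n) f t \<Longrightarrow> late g n f t" for f :: "real \<Rightarrow> real ^ 'n"
        unfolding late_def by (auto simp del: inverse_le_iff_le of_nat_Suc intro: less_le_trans)
      then show ?thesis by (auto simp: E_def)
    qed
    then show "decseq (\<lambda>n. D \<inter> H n)" by (intro decseq_SucI) (auto simp: H_def)
  qed (use DM HM in auto)
  moreover have "(\<Inter>n. D \<inter> H n) = {}"
  proof -
    have "\<exists>n. \<omega> \<notin> H n" if "\<omega> \<in> D" for \<omega>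
    proof -
      have \<omega>: "\<omega> \<in> space (P y)" "hits U B (\<lambda>t. X t \<omega>)" using that by (auto simp: D_def)
      then obtain u where u: "u \<ge> 0" "X u \<omega> \<in> B" "\<forall>s\<in>{0..u}. X s \<omega> \<in> U" by (auto simp: hits_def)
      have "\<exists>m::nat. \<forall>q\<in>rat_times. q \<le> u \<longrightarrow> inverse (Suc m) \<le> g (X q \<omega>)"
        using stays_iff_rat_times[OF cont[OF \<omega>(1)] g u(1)] u(3) by blast
      then obtain m :: nat where m: "\<And>q. q \<in> rat_times \<Longrightarrow> q \<le> u \<Longrightarrow> inverse (Suc m) \<le> g (X q \<omega>)" by blast
      obtain k :: nat where k: "u < real k" using reals_Archimedean2 by blast
      \<comment> \<open>For this \<open>n\<close> no time in \<open>[0, u]\<close> is late, while the times in \<open>E n\<close> precede the hit of \<open>B\<close> at \<open>u\<close>.\<close>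
      define n where "n = max m k"
      have "\<omega> \<notin> E n t" if t: "t \<in> rat_times" for t
      proof
        assume "\<omega> \<in> E n t"
        then have late: "late g n (\<lambda>s. X s \<omega>) t" and avoid: "\<forall>s\<in>{0..t}. X s \<omega> \<in> U - B"
          by (auto simp: E_def)
        have "t < u" using avoid u(1,2) by force
        moreover have "u < real n" using k by (simp add: n_def)
        ultimately obtain s where s: "s \<in> rat_times" "s \<le> t" "g (X s \<omega>) < inverse (Suc n)"
          using late by (auto simp: late_def)
        have "inverse (real (Suc n)) \<le> inverse (real (Suc m))"
          by (intro le_imp_inverse_le) (auto simp: n_def)
        moreover have "inverse (real (Suc m)) \<le> g (X s \<omega>)" using m s \<open>t < u\<close> by auto
        ultimately show False using s(3) by linarith
      qed
      then show ?thesis by (auto simp: H_def)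
    qed
    then show ?thesis by auto
  qed
  ultimately have "(\<lambda>n. emeasure (P y) (D \<inter> H n)) \<longlonglongrightarrow> 0" by simp
  then have "c * emeasure (P y) (space (P y) - D) \<le> 0"
    by (rule LIMSEQ_le_const) (use bound in auto)
  then have "emeasure (P y) (space (P y) - D) = 0"
    using assms(9) by (auto simp: c_def)
  then have "prob D = 1"
    using DM by (simp add: emeasure_eq_measure prob_compl)
  moreover have "{\<omega>\<in>space (P y). entry_time X B \<omega> < entry_time X (- U) \<omega>} = D"
    unfolding D_def using entry_time_less_iff_hits[where X=X, OF cont U] by auto
  ultimately show "hit_prob P X U B y = 1" by (simp add: hit_prob_def)
qed

end
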